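(* Let $F:(M^m,g_M)\to(N^n,g_N)$ be a Riemannian map between Riemannian manifolds such that the distribution $(range F_\ast)^\bot$ is totally geodesic. Let $\{F_\ast X_j\}_{r+1\le j\le m}$ and $\{e_k\}_{1\le k\le n_1}$ be orthonormal bases of $range F_\ast$ and $(range F_\ast)^\bot$, respectively. Then for $X,Y\in\Gamma(\ker F_\ast)^\bot$ (so $F_\ast X,F_\ast Y\in\Gamma(range F_\ast)$) and $V,W\in\Gamma(range F_\ast)^\bot$, the Ricci tensor $Ric$ of $(N,g_N)$ satisfies $$\begin{aligned}Ric(F_\ast X,F_\ast Y)=&\,Ric^{range F_\ast}(F_\ast X,F_\ast Y)-\sum_{k=1}^{n_1}\Big\{g_N(\mathcal{S}_{\nabla^{F\bot}_{e_k}e_k}F_\ast X,F_\ast Y)-g_N(\nabla^N_{e_k}\mathcal{S}_{e_k}F_\ast X,F_\ast Y)\\&+g_N(\mathcal{S}_{e_k}F_\ast X,\mathcal{S}_{e_k}F_\ast Y)+g_N(\nabla^N_{e_k}F_\ast X,\mathcal{S}_{e_k}F_\ast Y)\Big\},\end{aligned}$$ $$\begin{aligned}Ric(V,W)=&\,Ric^{(range F_\ast)^\bot}(V,W)-\sum_{j=r+1}^m\Big\{g_N(\mathcal{S}_{\nabla_V^{F\bot}W}F_\ast X_j,F_\ast X_j)+g_N(\mathcal{S}_VF_\ast X_j,\mathcal{S}_WF_\ast X_j)\\&-\nabla^N_V\big(g_N(\mathcal{S}_WF_\ast X_j,F_\ast X_j)\big)+2g_N(\mathcal{S}_WF_\ast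 X_j,\nabla_V^NF_\ast X_j)\Big\},\end{aligned}$$ and $$\begin{aligned}Ric(F_\ast X,V)=&\sum_{j=r+1}^m\Big\{g_N((\tilde\nabla_X\mathcal{S})_VF_\ast X_j,F_\ast X_j)-g_N((\tilde\nabla_{X_j}\mathcal{S})_VF_\ast X,F_\ast X_j)\Big\}\\&-\sum_{k=1}^{n_1}g_N\Big(\nabla_X^{F\bot}\nabla_{e_k}^{F\bot}V-\nabla_{e_k}^{F\bot}\nabla_X^{F\bot}V-\nabla^{F\bot}_{\nabla_X^{F\bot}e_k}V+\nabla^{F\bot}_{{}^\ast F_\ast(\mathcal{S}_{e_k}F_\ast X)}V+\nabla^{F\bot}_{{}^\ast F_\ast(\nabla^N_{e_k}F_\ast X)}V,\,e_k\Big).\end{aligned}$$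
   Context: A smooth map $F:(M^m,g_M)\to(N^n,g_N)$ with $0<rank F\le\min\{m,n\}$ is a Riemannian map if at each $p\in M$ the restriction of $F_{\ast p}$ to $(\ker F_{\ast p})^\bot$ is a linear isometry onto $range F_{\ast p}$. $r=\dim\ker F_\ast$, $m-r=rank F$, $n_1=\dim(range F_\ast)^\bot$, and $X_j\in\Gamma(\ker F_\ast)^\bot$. $(range F_\ast)^\bot$ is the orthogonal complement of $range F_\ast$ in $TN$; following the paper, $range F_\ast$ and $(range F_\ast)^\bot$ are regarded as complementary orthogonal distributions (subbundles of $TN$) on $N$. $\nabla^M,\nabla^N$ are the Levi-Civita connections, ${}^\ast F_\ast$ is the adjoint of $F_\ast$, $R^N(X_1,Y_1)Z_1=\nabla^N_{X_1}\nabla^N_{Y_1}Z_1-\nabla^N_{Y_1}\nabla^N_{X_1}Z_1-\nabla^N_{[X_1,Y_1]}Z_1$, and $Ric(X_1,Y_1)=trace(Z_1\mapsto R^N(Z_1,X_1)Y_1)$. For a function $h$, $\nabla^N_Vh=V(h)$. For $X\in\Gamma(TM)$ and $V\in\Gamma(range F_\ast)^\bot$, $\mathcal{S}_VF_\ast X\in\Gamma(range F_\ast)$ and $\nabla_X^{F\bot}V\in\Gamma(range F_\ast)^\bot$ are defined by $\nabla^N_{F_\ast X}V=-\mathcal{S}_VF_\ast X+\nabla^{F\bot}_XV$. For $U,V\in\Gamma(range F_\ast)^\bot$, $\nabla_U^{F\bot}V$ is the component of $\nabla^N_UV$ in $(range F_\ast)^\bot$; the distribution $(range F_\ast)^\bot$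 is totally geodesic if $\nabla^N_UV=\nabla^{F\bot}_UV$ for all such $U,V$. With $P$ the projection onto $range F_\ast$ and $\overset{N}{\nabla^F}$ the pullback connection ($\overset{N}{\nabla^F_X}F_\ast Y$ is $\nabla^N_{F_\ast X}F_\ast Y$ along $F$), $(\tilde\nabla_X\mathcal{S})_VF_\ast Y=F_\ast(\nabla_X^M\,{}^\ast F_\ast(\mathcal{S}_VF_\ast Y))-\mathcal{S}_{\nabla_X^{F\bot}V}F_\ast Y-\mathcal{S}_VP\overset{N}{\nabla^F_X}F_\ast Y$. $Ric^{range F_\ast}$ and $Ric^{(range F_\ast)^\bot}$ denote the contributions of the two distributions to the Ricci tensor, as used in the paper: $Ric^{range F_\ast}(F_\ast X,F_\ast Y)=\sum_{j=r+1}^mg_N(R^N(F_\ast X_j,F_\ast X)F_\ast Y,F_\ast X_j)$ and $Ric^{(range F_\ast)^\bot}(V,W)=\sum_{k=1}^{n_1}g_N(R^N(e_k,V)W,e_k)$. *)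

theory Defs
  imports "HOL-Analysis.Analysis" "HOL-Library.Function_Algebras"
begin

section \<open>Smooth functions, manifolds and tangent spaces\<close>

instantiation "fun" :: (type, real_vector) real_vector
begin

definition scaleR_fun_def: "c *\<^sub>R f = (\<lambda>x. c *\<^sub>R f x)"

instance
  by standard (simp_all add: scaleR_fun_def fun_eq_iff scaleR_add_left scaleR_add_right)

end

text \<open>Throughout, \<open>C\<^sup>k\<close> and \<open>C\<^sup>\<infinity>\<close> are only used on open sets, where the
  Frechet derivative is determined by the values on the set.\<close>

primrec Ck_on ::
  "nat \<Rightarrow> 'a::euclidean_space set \<Rightarrow> ('a \<Rightarrow> 'b::real_normed_vector) \<Rightarrow> bool" where
  "Ck_on 0 S f \<longleftrightarrow> continuous_on S f"
| "Ck_on (Suc k) S f \<longleftrightarrow>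
     f differentiable_on S \<and> (\<forall>v. Ck_on k S (\<lambda>x. frechet_derivative f (at x) v))"

definition smooth_on :: "'a::euclidean_space set \<Rightarrow> ('a \<Rightarrow> 'b::real_normed_vector) \<Rightarrow> bool" where
  "smooth_on S f \<longleftrightarrow> (\<forall>k. Ck_on k S f)"

type_synonym ('a, 'e) atlas = "('a set \<times> ('a \<Rightarrow> 'e)) set"

definition chart :: "'a::topological_space set \<Rightarrow> ('a \<Rightarrow> 'e::euclidean_space) \<Rightarrow> bool" where
  "chart U \<phi> \<longleftrightarrow> open U \<and> open (\<phi> ` U) \<and> (\<exists>\<psi>. homeomorphism U (\<phi> ` U) \<phi> \<psi>)"

text \<open>The manifold is the whole type, its dimension is that of the model space \<open>'e\<close>.
  The atlas need not be maximal.\<close>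

definition smooth_manifold ::
  "('a::{t2_space,second_countable_topology}, 'e::euclidean_space) atlas \<Rightarrow> bool" where
  "smooth_manifold \<A> \<longleftrightarrow>
     (\<forall>(U, \<phi>)\<in>\<A>. chart U \<phi>) \<and> (\<Union>(U, \<phi>)\<in>\<A>. U) = UNIV \<and>
     (\<forall>(U, \<phi>)\<in>\<A>. \<forall>(V, \<psi>)\<in>\<A>. smooth_on (\<phi> ` (U \<inter> V)) (\<psi> \<circ> inv_into U \<phi>))"

definition smooth_fun ::
  "('a::topological_space, 'e::euclidean_space) atlas \<Rightarrow> 'a set \<Rightarrow> ('a \<Rightarrow> real) \<Rightarrow> bool" where
  "smooth_fun \<A> W f \<longleftrightarrow> (\<forall>(U, \<phi>)\<in>\<A>. smooth_on (\<phi> ` (U \<inter> W)) (f \<circ> inv_into U \<phi>))"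

definition smooth_near ::
  "('a::topological_space, 'e::euclidean_space) atlas \<Rightarrow> 'a \<Rightarrow> ('a \<Rightarrow> real) \<Rightarrow> bool" where
  "smooth_near \<A> p f \<longleftrightarrow> (\<exists>W. open W \<and> p \<in> W \<and> smooth_fun \<A> W f)"

definition smooth_map ::
  "('a::topological_space, 'e::euclidean_space) atlas \<Rightarrow>
   ('b::topological_space, 'd::euclidean_space) atlas \<Rightarrow> ('a \<Rightarrow> 'b) \<Rightarrow> bool" where
  "smooth_map \<A> \<B> F \<longleftrightarrow> continuous_on UNIV F \<and>
     (\<forall>(U, \<phi>)\<in>\<A>. \<forall>(V, \<psi>)\<in>\<B>. smooth_on (\<phi> ` (U \<inter> F -` V)) (\<psi> \<circ> F \<circ> inv_into U \<phi>))"

text \<open>Tangent vectors at \<open>p\<close> are the derivations of the algebra of germs at \<open>p\<close> of smooth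
  functions. A germ is represented by total functions that are smooth near \<open>p\<close>; a tangent vector
  vanishes by convention on all other functions, so that equal derivations are equal as HOL
  functions and the linear structure is the pointwise one.\<close>

type_synonym 'a tangent = "('a \<Rightarrow> real) \<Rightarrow> real"
type_synonym 'a vfield = "'a \<Rightarrow> 'a tangent"

definition tangent_space ::
  "('a::topological_space, 'e::euclidean_space) atlas \<Rightarrow> 'a \<Rightarrow> 'a tangent set" where
  "tangent_space \<A> p = {v.
     (\<forall>f. \<not> smooth_near \<A> p f \<longrightarrow> v f = 0) \<and>
     (\<forall>f h. smooth_near \<A> p f \<longrightarrow> eventually (\<lambda>x. f x = h x) (nhds p) \<longrightarrow> v f = v h) \<and>
     (\<forall>f h. smooth_near \<A> p f \<longrightarrow> smooth_near \<A> p h \<longrightarrow>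
        v (\<lambda>x. f x + h x) = v f + v h \<and> v (\<lambda>x. f x * h x) = v f * h p + f p * v h) \<and>
     (\<forall>c f. smooth_near \<A> p f \<longrightarrow> v (\<lambda>x. c * f x) = c * v f)}"

definition pushforward ::
  "('b::topological_space, 'd::euclidean_space) atlas \<Rightarrow> ('a \<Rightarrow> 'b) \<Rightarrow> 'a \<Rightarrow> 'a tangent \<Rightarrow> 'b tangent"
  where
  "pushforward \<B> F p v = (\<lambda>f. if smooth_near \<B> (F p) f then v (f \<circ> F) else 0)"

text \<open>Smooth vector fields on an open set \<open>U\<close>; the values outside \<open>U\<close> are irrelevant.\<close>

definition vfields ::
  "('a::topological_space, 'e::euclidean_space) atlas \<Rightarrow> 'a set \<Rightarrow> 'a vfield set" where
  "vfields \<A> U = {X. (\<forall>p\<in>U. X p \<in> tangent_space \<A> p) \<and>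
     (\<forall>W f. open W \<longrightarrow> W \<subseteq> U \<longrightarrow> smooth_fun \<A> W f \<longrightarrow> smooth_fun \<A> W (\<lambda>p. X p f))}"

definition lie_bracket ::
  "('a::topological_space, 'e::euclidean_space) atlas \<Rightarrow> 'a vfield \<Rightarrow> 'a vfield \<Rightarrow> 'a vfield" where
  "lie_bracket \<A> X Y = (\<lambda>p f. if smooth_near \<A> p f
     then X p (\<lambda>x. Y x f) - Y p (\<lambda>x. X x f) else 0)"


section \<open>Riemannian metrics, the Levi-Civita connection and curvature\<close>

type_synonym 'a metric_tensor = "'a \<Rightarrow> 'a tangent \<Rightarrow> 'a tangent \<Rightarrow> real"

definition riemannian_metric ::
  "('a::topological_space, 'e::euclidean_space) atlas \<Rightarrow> 'a metric_tensor \<Rightarrow> bool" where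
  "riemannian_metric \<A> g \<longleftrightarrow>
     (\<forall>p. \<forall>u\<in>tangent_space \<A> p. \<forall>v\<in>tangent_space \<A> p.
        g p u v = g p v u \<and> (u \<noteq> 0 \<longrightarrow> g p u u > 0) \<and>
        (\<forall>w\<in>tangent_space \<A> p. g p (u + v) w = g p u w + g p v w) \<and>
        (\<forall>c. g p (c *\<^sub>R u) v = c * g p u v)) \<and>
     (\<forall>U. open U \<longrightarrow> (\<forall>X\<in>vfields \<A> U. \<forall>Y\<in>vfields \<A> U. smooth_fun \<A> U (\<lambda>p. g p (X p) (Y p))))"

text \<open>\<open>nab p v Y\<close> is the covariant derivative at \<open>p\<close>, in the direction \<open>v\<close> tangent at \<open>p\<close>, of a
  vector field \<open>Y\<close> that is smooth on some open neighbourhood \<open>U\<close> of \<open>p\<close>. Connections are local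
  operators, so they act on fields over any open set; the third clause says that the result does
  not depend on the values of \<open>Y\<close> outside \<open>U\<close>.\<close>

type_synonym 'a conn = "'a \<Rightarrow> 'a tangent \<Rightarrow> 'a vfield \<Rightarrow> 'a tangent"

definition cov :: "'a conn \<Rightarrow> 'a vfield \<Rightarrow> 'a vfield \<Rightarrow> 'a vfield" where
  "cov nab X Y = (\<lambda>p. nab p (X p) Y)"

definition affine_connection ::
  "('a::topological_space, 'e::euclidean_space) atlas \<Rightarrow> 'a conn \<Rightarrow> bool" where
  "affine_connection \<A> nab \<longleftrightarrow> (\<forall>U. open U \<longrightarrow>
     (\<forall>X\<in>vfields \<A> U. \<forall>Y\<in>vfields \<A> U. cov nab X Y \<in> vfields \<A> U) \<and>
     (\<forall>p\<in>U. \<forall>Y\<in>vfields \<A> U. \<forall>v\<in>tangent_space \<A> p.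
        nab p v Y \<in> tangent_space \<A> p \<and>
        (\<forall>Z\<in>vfields \<A> U. (\<forall>x\<in>U. Z x = Y x) \<longrightarrow> nab p v Z = nab p v Y) \<and>
        (\<forall>w\<in>tangent_space \<A> p. nab p (v + w) Y = nab p v Y + nab p w Y) \<and>
        (\<forall>c. nab p (c *\<^sub>R v) Y = c *\<^sub>R nab p v Y) \<and>
        (\<forall>Z\<in>vfields \<A> U. nab p v (\<lambda>x. Y x + Z x) = nab p v Y + nab p v Z) \<and>
        (\<forall>f. smooth_fun \<A> U f \<longrightarrow>
           nab p v (\<lambda>x. f x *\<^sub>R Y x) = v f *\<^sub>R Y p + f p *\<^sub>R nab p v Y)))"

definition levi_civita ::
  "('a::topological_space, 'e::euclidean_space) atlas \<Rightarrow> 'a metric_tensor \<Rightarrow> 'a conn \<Rightarrow> bool" where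
  "levi_civita \<A> g nab \<longleftrightarrow> affine_connection \<A> nab \<and>
     (\<forall>U. open U \<longrightarrow> (\<forall>X\<in>vfields \<A> U. \<forall>Y\<in>vfields \<A> U. \<forall>p\<in>U.
        cov nab X Y p - cov nab Y X p = lie_bracket \<A> X Y p \<and>
        (\<forall>Z\<in>vfields \<A> U. X p (\<lambda>x. g x (Y x) (Z x)) =
           g p (cov nab X Y p) (Z p) + g p (Y p) (cov nab X Z p))))"

definition curvature ::
  "('a::topological_space, 'e::euclidean_space) atlas \<Rightarrow> 'a conn \<Rightarrow>
   'a vfield \<Rightarrow> 'a vfield \<Rightarrow> 'a vfield \<Rightarrow> 'a vfield" where
  "curvature \<A> nab X Y Z = (\<lambda>p.
     cov nab X (cov nab Y Z) p - cov nab Y (cov nab X Z) p - cov nab (lie_bracket \<A> X Y) Z p)"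

text \<open>The curvature tensor at \<open>p\<close>: the common value at \<open>p\<close> of \<open>R(X,Y)Z\<close> for all local
  smooth fields extending the given tangent vectors.\<close>

definition curvature_at ::
  "('a::topological_space, 'e::euclidean_space) atlas \<Rightarrow> 'a conn \<Rightarrow>
   'a \<Rightarrow> 'a tangent \<Rightarrow> 'a tangent \<Rightarrow> 'a tangent \<Rightarrow> 'a tangent" where
  "curvature_at \<A> nab p x y z = (THE w. \<forall>U X Y Z. open U \<longrightarrow> p \<in> U \<longrightarrow>
     X \<in> vfields \<A> U \<longrightarrow> Y \<in> vfields \<A> U \<longrightarrow> Z \<in> vfields \<A> U \<longrightarrow>
     X p = x \<longrightarrow> Y p = y \<longrightarrow> Z p = z \<longrightarrow> curvature \<A> nab X Y Z p = w)"

text \<open>Trace of a linear endomorphism \<open>T\<close> of a finite-dimensional subspace \<open>V\<close>: the sum of the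
  diagonal matrix entries with respect to an arbitrarily chosen basis.\<close>

definition trace_on :: "'v::real_vector set \<Rightarrow> ('v \<Rightarrow> 'v) \<Rightarrow> real" where
  "trace_on V T = (let B = (SOME B. B \<subseteq> V \<and> independent B \<and> V \<subseteq> span B)
                   in \<Sum>b\<in>B. representation B (T b) b)"

definition ricci ::
  "('a::topological_space, 'e::euclidean_space) atlas \<Rightarrow> 'a conn \<Rightarrow>
   'a \<Rightarrow> 'a tangent \<Rightarrow> 'a tangent \<Rightarrow> real" where
  "ricci \<A> nab p x y = trace_on (tangent_space \<A> p) (\<lambda>z. curvature_at \<A> nab p z x y)"

text \<open>The contribution to the Ricci tensor of a distribution with frame \<open>E\<close> indexed by \<open>I\<close>.\<close>

definition ricci_part ::
  "('a::topological_space, 'e::euclidean_space) atlas \<Rightarrow> 'a metric_tensor \<Rightarrow> 'a conn \<Rightarrow>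
   nat set \<Rightarrow> (nat \<Rightarrow> 'a vfield) \<Rightarrow> 'a vfield \<Rightarrow> 'a vfield \<Rightarrow> 'a \<Rightarrow> real" where
  "ricci_part \<A> g nab I E X Y p = (\<Sum>i\<in>I. g p (curvature \<A> nab (E i) X Y p) (E i p))"


section \<open>Distributions\<close>

type_synonym 'a distribution = "'a \<Rightarrow> 'a tangent set"

definition smooth_distribution ::
  "('a::topological_space, 'e::euclidean_space) atlas \<Rightarrow> nat \<Rightarrow> 'a distribution \<Rightarrow> bool" where
  "smooth_distribution \<A> k D \<longleftrightarrow>
     (\<forall>p. subspace (D p) \<and> D p \<subseteq> tangent_space \<A> p \<and> dim (D p) = k) \<and>
     (\<forall>p. \<exists>W E. open W \<and> p \<in> W \<and> (\<forall>i<k. E i \<in> vfields \<A> W) \<and>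
        (\<forall>x\<in>W. D x = span ((\<lambda>i. E i x) ` {..<k})))"

definition sections ::
  "('a::topological_space, 'e::euclidean_space) atlas \<Rightarrow> 'a distribution \<Rightarrow> 'a set \<Rightarrow> 'a vfield set"
  where
  "sections \<A> D U = {X \<in> vfields \<A> U. \<forall>p\<in>U. X p \<in> D p}"

definition orth_compl ::
  "('a::topological_space, 'e::euclidean_space) atlas \<Rightarrow> 'a metric_tensor \<Rightarrow>
   'a distribution \<Rightarrow> 'a distribution" where
  "orth_compl \<A> g D p = {v \<in> tangent_space \<A> p. \<forall>w\<in>D p. g p v w = 0}"

definition orth_proj ::
  "'a metric_tensor \<Rightarrow> 'a distribution \<Rightarrow> 'a \<Rightarrow> 'a tangent \<Rightarrow> 'a tangent" where
  "orth_proj g D p v = (THE u. u \<in> D p \<and> (\<forall>w\<in>D p. g p (v - u) w = 0))"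

definition orthonormal_frame ::
  "'a metric_tensor \<Rightarrow> 'a distribution \<Rightarrow> 'a set \<Rightarrow> nat set \<Rightarrow> (nat \<Rightarrow> 'a vfield) \<Rightarrow> bool" where
  "orthonormal_frame g D U I E \<longleftrightarrow> (\<forall>p\<in>U.
     (\<forall>i\<in>I. \<forall>j\<in>I. g p (E i p) (E j p) = (if i = j then 1 else 0)) \<and>
     span ((\<lambda>i. E i p) ` I) = D p)"


section \<open>Riemannian maps\<close>

definition ker_dist ::
  "('a::topological_space, 'e::euclidean_space) atlas \<Rightarrow>
   ('b::topological_space, 'd::euclidean_space) atlas \<Rightarrow> ('a \<Rightarrow> 'b) \<Rightarrow> 'a distribution" where
  "ker_dist \<A> \<B> F p = {v \<in> tangent_space \<A> p. pushforward \<B> F p v = 0}"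

definition range_at ::
  "('a::topological_space, 'e::euclidean_space) atlas \<Rightarrow>
   ('b::topological_space, 'd::euclidean_space) atlas \<Rightarrow> ('a \<Rightarrow> 'b) \<Rightarrow> 'a \<Rightarrow> 'b tangent set" where
  "range_at \<A> \<B> F p = pushforward \<B> F p ` tangent_space \<A> p"

definition horizontal ::
  "('a::topological_space, 'e::euclidean_space) atlas \<Rightarrow>
   ('b::topological_space, 'd::euclidean_space) atlas \<Rightarrow> 'a metric_tensor \<Rightarrow> ('a \<Rightarrow> 'b) \<Rightarrow>
   'a distribution" where
  "horizontal \<A> \<B> g F = orth_compl \<A> g (ker_dist \<A> \<B> F)"

definition riemannian_map ::
  "('a::topological_space, 'e::euclidean_space) atlas \<Rightarrow> 'a metric_tensor \<Rightarrow>
   ('b::topological_space, 'd::euclidean_space) atlas \<Rightarrow> 'b metric_tensor \<Rightarrow> ('a \<Rightarrow> 'b) \<Rightarrow> bool"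
  where
  "riemannian_map \<A> g \<B> h F \<longleftrightarrow> smooth_map \<A> \<B> F \<and>
     (\<exists>k. 0 < k \<and> k \<le> min DIM('e) DIM('d) \<and> (\<forall>p. dim (range_at \<A> \<B> F p) = k)) \<and>
     (\<forall>p. bij_betw (pushforward \<B> F p) (horizontal \<A> \<B> g F p) (range_at \<A> \<B> F p) \<and>
        (\<forall>u\<in>horizontal \<A> \<B> g F p. \<forall>v\<in>horizontal \<A> \<B> g F p.
           h (F p) (pushforward \<B> F p u) (pushforward \<B> F p v) = g p u v))"

definition adjoint_at ::
  "('a::topological_space, 'e::euclidean_space) atlas \<Rightarrow> 'a metric_tensor \<Rightarrow>
   ('b::topological_space, 'd::euclidean_space) atlas \<Rightarrow> 'b metric_tensor \<Rightarrow> ('a \<Rightarrow> 'b) \<Rightarrow>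
   'a \<Rightarrow> 'b tangent \<Rightarrow> 'a tangent" where
  "adjoint_at \<A> g \<B> h F p w = (THE u. u \<in> tangent_space \<A> p \<and>
     (\<forall>v\<in>tangent_space \<A> p. g p u v = h (F p) w (pushforward \<B> F p v)))"

text \<open>A section of the range bundle written \<open>F\<^sub>*X\<close> is a vector field \<open>A\<close> on an open set of the
  target which represents the pushforward of the field \<open>X\<close> on an open set \<open>\<Omega>\<close> of the source.\<close>

definition F_related ::
  "('b::topological_space, 'd::euclidean_space) atlas \<Rightarrow> ('a \<Rightarrow> 'b) \<Rightarrow> 'a set \<Rightarrow>
   'a vfield \<Rightarrow> 'b vfield \<Rightarrow> bool" where
  "F_related \<B> F \<Omega> X A \<longleftrightarrow> (\<forall>p\<in>\<Omega>. A (F p) = pushforward \<B> F p (X p))"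

text \<open>Here \<open>D\<close> is the distribution \<open>range F\<^sub>*\<close> on the target. The two operators
  are the \<open>D\<close>-component (up to sign) and the \<open>D\<^sup>\<bottom>\<close>-component of the covariant derivative
  of \<open>V\<close> at \<open>q\<close> in the direction \<open>w\<close>: for \<open>w = F\<^sub>*X\<close> they are \<open>S\<^sub>V F\<^sub>*X\<close> and
  the normal derivative of \<open>V\<close> along \<open>X\<close>, and for \<open>w\<close> in \<open>D\<^sup>\<bottom>\<close> the latter is the normal
  derivative of \<open>V\<close> along \<open>w\<close>.\<close>

definition shape ::
  "'a metric_tensor \<Rightarrow> 'a conn \<Rightarrow> 'a distribution \<Rightarrow> 'a \<Rightarrow> 'a vfield \<Rightarrow> 'a tangent \<Rightarrow> 'a tangent"
  where
  "shape g nab D q V w = - orth_proj g D q (nab q w V)"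

definition normal_conn ::
  "('a::topological_space, 'e::euclidean_space) atlas \<Rightarrow> 'a metric_tensor \<Rightarrow> 'a conn \<Rightarrow>
   'a distribution \<Rightarrow> 'a conn" where
  "normal_conn \<A> g nab D q w V = orth_proj g (orth_compl \<A> g D) q (nab q w V)"

definition perp_totally_geodesic ::
  "('a::topological_space, 'e::euclidean_space) atlas \<Rightarrow> 'a metric_tensor \<Rightarrow> 'a conn \<Rightarrow>
   'a distribution \<Rightarrow> bool" where
  "perp_totally_geodesic \<A> g nab D \<longleftrightarrow> (\<forall>U. open U \<longrightarrow>
     (\<forall>V\<in>sections \<A> (orth_compl \<A> g D) U. \<forall>W\<in>sections \<A> (orth_compl \<A> g D) U. \<forall>q\<in>U.
        cov nab V W q = cov (normal_conn \<A> g nab D) V W q))"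

text \<open>The covariant derivative of \<open>S\<close> along \<open>X\<close>, applied to \<open>V\<close> and \<open>F\<^sub>*Y = B\<close>, at a
  point \<open>p\<close> of the source; \<open>A = F\<^sub>*X\<close> is needed as a field on the target only to
  differentiate \<open>V\<close>.\<close>

definition shape_deriv ::
  "('a::topological_space, 'e::euclidean_space) atlas \<Rightarrow> 'a metric_tensor \<Rightarrow> 'a conn \<Rightarrow>
   ('b::topological_space, 'd::euclidean_space) atlas \<Rightarrow> 'b metric_tensor \<Rightarrow> 'b conn \<Rightarrow>
   ('a \<Rightarrow> 'b) \<Rightarrow> 'b distribution \<Rightarrow> 'a vfield \<Rightarrow> 'b vfield \<Rightarrow> 'b vfield \<Rightarrow> 'b vfield \<Rightarrow>
   'a \<Rightarrow> 'b tangent" where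
  "shape_deriv \<A> g nabM \<B> h nabN F D X A V B p =
     pushforward \<B> F p
       (nabM p (X p) (\<lambda>x. adjoint_at \<A> g \<B> h F x (shape h nabN D (F x) V (B (F x)))))
     - shape h nabN D (F p) (cov (normal_conn \<B> h nabN D) A V) (B (F p))
     - shape h nabN D (F p) V (orth_proj h D (F p) (nabN (F p) (pushforward \<B> F p (X p)) B))"

end

theory Submission
  imports Defs
begin

text \<open>On \<open>U\<close> the fields \<open>F\<^sub>*X\<^sub>j\<close> and \<open>e\<^sub>k\<close> form an orthonormal frame, so by tensoriality of the curvature
  the Ricci tensor is the sum of \<open>g (R(E, X)Y) E\<close> over the frame. The two pure sums are the
  contributions of the distributions. The mixed terms follow by splitting every derivative of a normal
  field \<open>V\<close> along \<open>X\<close> into \<open>- S\<^sub>V X\<close> and its normal part: since the normal distribution is totally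
  geodesic, derivatives in normal directions preserve both distributions. The operators \<open>S\<^sub>V\<close> are
  symmetric along the image of \<open>F\<close>, because brackets of \<open>F\<close>-related fields are \<open>F\<close>-related and so
  tangent to the range. Finally, by the Koszul formula \<open>F\<^sub>*\<close> carries the covariant derivative of
  horizontal fields to the range component of that of their images, which turns the tangential part of
  \<open>R(X\<^sub>j, X)V\<close> into the covariant derivatives of \<open>S\<close>.\<close>

section \<open>Calculus of smooth functions\<close>

text \<open>A section \<open>F\<^sub>*X\<close> lives only along \<open>F\<close>, while the
  connection of the target differentiates fields on open sets; so each section is carried by a field
  on \<open>U\<close>, and the final identities are read off at the single point
  \<open>q = F p\<close>. Staying on the image matters: \<open>D\<close> is tied to the range only
  there, and elsewhere brackets of sections of \<open>D\<close> may leave \<open>D\<close>, so that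
  the shape operators need not be symmetric.

  The frames over \<open>U\<close> do more than index the sums. Tangent spaces are spaces of
  derivations without coordinates, and expansion in the frame is what supplies finite dimension,
  smooth projections, extension of a vector to a field, and tensoriality without cutoff functions.
  Likewise the horizontal lift of a section of \<open>D\<close> is smooth because its coefficients
  in the \<open>Xs\<close> are those of the section in the \<open>As\<close>, composed with
  \<open>F\<close>; this is why the calculus must reach composition with a smooth map.\<close>

lemma differentiable_on_openD:
  "f differentiable_on S \<Longrightarrow> open S \<Longrightarrow> x \<in> S \<Longrightarrow> f differentiable (at x)"
  by (simp add: differentiable_on_eq_differentiable_at)

lemma has_frechet_derivative_on_open:
  "f differentiable_on S \<Longrightarrow> open S \<Longrightarrow> x \<in> S \<Longrightarrow> (f has_derivative frechet_derivative f (at x)) (at x)"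
  by (simp add: differentiable_on_openD frechet_derivative_works[symmetric])

lemma Ck_on_cong:
  assumes "open S" "\<And>x. x \<in> S \<Longrightarrow> f x = h x" "Ck_on k S f"
  shows "Ck_on k S h"
  using assms(2,3)
proof (induction k arbitrary: f h)
  case 0
  then show ?case using continuous_on_cong[of S S f h] by simp
next
  case (Suc k)
  have der: "(h has_derivative frechet_derivative f (at x)) (at x)" if "x \<in> S" for x
  proof (rule has_derivative_transform_within_open[OF _ \<open>open S\<close> that])
    show "(f has_derivative frechet_derivative f (at x)) (at x)"
      using Suc.prems that \<open>open S\<close> by (auto intro: has_frechet_derivative_on_open)
  qed (use Suc.prems in auto)
  have "h differentiable_on S"
    using der \<open>open S\<close> by (auto simp: differentiable_on_eq_differentiable_at differentiable_def)
  moreover have "Ck_on k S (\<lambda>x. frechet_derivative h (at x) v)" for v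
  proof (rule Suc.IH)
    show "Ck_on k S (\<lambda>x. frechet_derivative f (at x) v)" using Suc.prems by simp
  qed (simp add: frechet_derivative_at[OF der, symmetric])
  ultimately show ?case by simp
qed

lemma Ck_on_subset:
  assumes "Ck_on k S f" "T \<subseteq> S"
  shows "Ck_on k T f"
  using assms(1)
proof (induction k arbitrary: f)
  case 0
  then show ?case using continuous_on_subset[of S f T] assms(2) by simp
next
  case (Suc k)
  then show ?case using differentiable_on_subset[of f S T] assms(2) by simp
qed

lemma Ck_on_Suc_imp: "Ck_on (Suc k) S f \<Longrightarrow> Ck_on k S f"
  by (induction k arbitrary: f) (auto intro: differentiable_imp_continuous_on)

text \<open>The Frechet derivative is taken in the full space, so it depends only on the germ and
  the class can be checked near each point. This serves maps between manifolds, where one chart of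
  the target covers only part of the image.\<close>

lemma Ck_on_local:
  assumes "\<And>x. x \<in> S \<Longrightarrow> \<exists>T. open T \<and> x \<in> T \<and> Ck_on k T f"
  shows "Ck_on k S f"
  using assms
proof (induction k arbitrary: f)
  case 0
  have "isCont f x" if x: "x \<in> S" for x
    using "0.prems"[OF x] continuous_on_eq_continuous_at by auto
  then show ?case by (simp add: continuous_at_imp_continuous_on)
next
  case (Suc k)
  have loc: "\<exists>T. open T \<and> x \<in> T \<and> f differentiable_on T \<and>
      (\<forall>v. Ck_on k T (\<lambda>x. frechet_derivative f (at x) v))" if "x \<in> S" for x
    using Suc.prems[OF that] by simp
  have "f differentiable (at x)" if "x \<in> S" for x
    using loc[OF that] differentiable_on_openD by blast
  then have "f differentiable_on S" by (simp add: differentiable_at_imp_differentiable_on)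
  moreover have "Ck_on k S (\<lambda>x. frechet_derivative f (at x) v)" for v
    by (rule Suc.IH) (use loc in blast)
  ultimately show ?case by simp
qed

lemma Ck_on_const: "Ck_on k S (\<lambda>_. c)"
  by (induction k arbitrary: c) (auto simp: frechet_derivative_const)

lemma Ck_on_linear:
  assumes "bounded_linear L" "open S" "Ck_on k S f"
  shows "Ck_on k S (\<lambda>x. L (f x))"
  using assms(3)
proof (induction k arbitrary: f)
  case 0
  then show ?case using bounded_linear.continuous_on[OF assms(1)] by auto
next
  case (Suc k)
  have der: "((\<lambda>x. L (f x)) has_derivative (\<lambda>v. L (frechet_derivative f (at x) v))) (at x)"
    if "x \<in> S" for x
    using Suc.prems that \<open>open S\<close>
    by (auto intro!: bounded_linear.has_derivative[OF assms(1)] has_frechet_derivative_on_open)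
  have "(\<lambda>x. L (f x)) differentiable_on S"
    using der \<open>open S\<close> by (auto simp: differentiable_on_eq_differentiable_at differentiable_def)
  moreover have "Ck_on k S (\<lambda>x. frechet_derivative (\<lambda>x. L (f x)) (at x) v)" for v
  proof (rule Ck_on_cong[OF \<open>open S\<close>])
    show "Ck_on k S (\<lambda>x. L (frechet_derivative f (at x) v))"
      using Suc by simp
  qed (simp add: frechet_derivative_at[OF der, symmetric])
  ultimately show ?case by simp
qed

lemma Ck_on_add:
  assumes "open S" "Ck_on k S f" "Ck_on k S h"
  shows "Ck_on k S (\<lambda>x. f x + h x)"
  using assms(2,3)
proof (induction k arbitrary: f h)
  case 0
  then show ?case by (auto intro: continuous_on_add)
next
  case (Suc k)
  have der: "((\<lambda>x. f x + h x) has_derivative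
      (\<lambda>v. frechet_derivative f (at x) v + frechet_derivative h (at x) v)) (at x)"
    if "x \<in> S" for x
    using Suc.prems that \<open>open S\<close>
    by (auto intro!: has_derivative_add has_frechet_derivative_on_open)
  have "(\<lambda>x. f x + h x) differentiable_on S"
    using der \<open>open S\<close> by (auto simp: differentiable_on_eq_differentiable_at differentiable_def)
  moreover have "Ck_on k S (\<lambda>x. frechet_derivative (\<lambda>x. f x + h x) (at x) v)" for v
  proof (rule Ck_on_cong[OF \<open>open S\<close>])
    show "Ck_on k S (\<lambda>x. frechet_derivative f (at x) v + frechet_derivative h (at x) v)"
      using Suc by simp
  qed (simp add: frechet_derivative_at[OF der, symmetric])
  ultimately show ?case by simp
qed

lemma Ck_on_mult:
  fixes f h :: "'a::euclidean_space \<Rightarrow> real"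
  assumes "open S" "Ck_on k S f" "Ck_on k S h"
  shows "Ck_on k S (\<lambda>x. f x * h x)"
  using assms(2,3)
proof (induction k arbitrary: f h)
  case 0
  then show ?case by (auto intro: continuous_on_mult)
next
  case (Suc k)
  have der: "((\<lambda>x. f x * h x) has_derivative
      (\<lambda>v. f x * frechet_derivative h (at x) v + frechet_derivative f (at x) v * h x)) (at x)"
    if "x \<in> S" for x
    using Suc.prems that \<open>open S\<close>
    by (auto intro!: has_derivative_mult has_frechet_derivative_on_open)
  have "(\<lambda>x. f x * h x) differentiable_on S"
    using der \<open>open S\<close> by (auto simp: differentiable_on_eq_differentiable_at differentiable_def)
  moreover have "Ck_on k S (\<lambda>x. frechet_derivative (\<lambda>x. f x * h x) (at x) v)" for v
  proof (rule Ck_on_cong[OF \<open>open S\<close>])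
    have "Ck_on k S f" "Ck_on k S h"
      using Suc.prems Ck_on_Suc_imp by blast+
    then show "Ck_on k S (\<lambda>x. f x * frechet_derivative h (at x) v + frechet_derivative f (at x) v * h x)"
      using Suc by (simp add: Ck_on_add[OF \<open>open S\<close>])
  qed (simp add: frechet_derivative_at[OF der, symmetric])
  ultimately show ?case by simp
qed

lemma Ck_on_sum:
  assumes "open S" "\<And>i. i \<in> I \<Longrightarrow> Ck_on k S (f i)"
  shows "Ck_on k S (\<lambda>x. \<Sum>i\<in>I. f i x)"
  using assms(2)
  by (induction I rule: infinite_finite_induct) (simp_all add: Ck_on_const Ck_on_add[OF assms(1)])

text \<open>\<open>Ck_on\<close> controls derivatives in fixed directions only, whereas the chain
  rule differentiates \<open>f\<close> in the moving direction \<open>h'(x) v\<close>. Expanding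
  that direction over \<open>Basis\<close> leaves a finite sum of products, to which the induction
  hypothesis applies.\<close>

lemma Ck_on_compose:
  fixes f :: "'d::euclidean_space \<Rightarrow> real" and h :: "'e::euclidean_space \<Rightarrow> 'd"
  assumes "open S" "open T" "h ` S \<subseteq> T" "Ck_on k T f" "Ck_on k S h"
  shows "Ck_on k S (\<lambda>x. f (h x))"
  using assms(4,5)
proof (induction k arbitrary: f)
  case 0
  then show ?case using continuous_on_compose2[of T f S h] assms(3) by simp
next
  case (Suc k)
  have der: "((\<lambda>x. f (h x)) has_derivative
      (\<lambda>v. \<Sum>b\<in>Basis. (frechet_derivative h (at x) v \<bullet> b) * frechet_derivative f (at (h x)) b)) (at x)"
    if "x \<in> S" for x
  proof -
    have f': "(f has_derivative frechet_derivative f (at (h x))) (at (h x))"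
      using Suc.prems that assms(2,3) by (auto intro!: has_frechet_derivative_on_open)
    have h': "(h has_derivative frechet_derivative h (at x)) (at x)"
      using Suc.prems that assms(1) by (auto intro!: has_frechet_derivative_on_open)
    have lin: "linear (frechet_derivative f (at (h x)))"
      using f' has_derivative_linear by blast
    have expand: "frechet_derivative f (at (h x)) w
        = (\<Sum>b\<in>Basis. (w \<bullet> b) * frechet_derivative f (at (h x)) b)" for w
    proof -
      have "frechet_derivative f (at (h x)) w
          = frechet_derivative f (at (h x)) (\<Sum>b\<in>Basis. (w \<bullet> b) *\<^sub>R b)"
        by (simp add: euclidean_representation)
      also have "\<dots> = (\<Sum>b\<in>Basis. (w \<bullet> b) * frechet_derivative f (at (h x)) b)"
        by (simp add: linear_sum[OF lin] linear_cmul[OF lin])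
      finally show ?thesis .
    qed
    have "(\<lambda>v. frechet_derivative f (at (h x)) (frechet_derivative h (at x) v)) =
        (\<lambda>v. \<Sum>b\<in>Basis. (frechet_derivative h (at x) v \<bullet> b) * frechet_derivative f (at (h x)) b)"
      by (rule ext) (rule expand)
    then show ?thesis
      using has_derivative_compose[OF h' f'] by (simp only:)
  qed
  have "(\<lambda>x. f (h x)) differentiable_on S"
    using der \<open>open S\<close> by (auto simp: differentiable_on_eq_differentiable_at differentiable_def)
  moreover have "Ck_on k S (\<lambda>x. frechet_derivative (\<lambda>x. f (h x)) (at x) v)" for v
  proof (rule Ck_on_cong[OF \<open>open S\<close>])
    have "Ck_on k S h" using Suc.prems Ck_on_Suc_imp by blast
    show "Ck_on k S (\<lambda>x. \<Sum>b\<in>Basis. (frechet_derivative h (at x) v \<bullet> b)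
        * frechet_derivative f (at (h x)) b)"
    proof (intro Ck_on_sum[OF assms(1)] Ck_on_mult[OF assms(1)])
      show "Ck_on k S (\<lambda>x. frechet_derivative h (at x) v \<bullet> b)" for b
        by (rule Ck_on_linear[OF bounded_linear_inner_left assms(1)]) (use Suc.prems in simp)
      show "Ck_on k S (\<lambda>x. frechet_derivative f (at (h x)) b)" for b
        by (rule Suc.IH) (use Suc.prems \<open>Ck_on k S h\<close> in simp_all)
    qed
  qed (simp add: frechet_derivative_at[OF der, symmetric])
  ultimately show ?case by simp
qed

section \<open>Charts and smooth functions on manifolds\<close>

lemma open_chart_image:
  assumes "chart U \<phi>" "open W"
  shows "open (\<phi> ` (U \<inter> W))"
proof -
  obtain \<psi> where "homeomorphism U (\<phi> ` U) \<phi> \<psi>" "open (\<phi> ` U)"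
    using assms(1) by (auto simp: chart_def)
  then have "openin (top_of_set (\<phi> ` U)) (\<phi> ` (U \<inter> W))"
    using homeomorphism_imp_open_map openin_open_Int[OF assms(2)] by blast
  then show ?thesis using openin_open_eq[OF \<open>open (\<phi> ` U)\<close>] by blast
qed

lemma inv_into_chart:
  assumes "chart U \<phi>" "x \<in> U"
  shows "inv_into U \<phi> (\<phi> x) = x"
proof -
  obtain \<psi> where "homeomorphism U (\<phi> ` U) \<phi> \<psi>" using assms(1) by (auto simp: chart_def)
  then have "inj_on \<phi> U" by (auto simp: homeomorphism_def intro: inj_on_inverseI)
  then show ?thesis using assms(2) by simp
qed

lemma smooth_manifold_chart: "smooth_manifold \<A> \<Longrightarrow> (U, \<phi>) \<in> \<A> \<Longrightarrow> chart U \<phi>"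
  by (auto simp: smooth_manifold_def)

lemma smooth_funI:
  assumes "\<And>U \<phi> k. (U, \<phi>) \<in> \<A> \<Longrightarrow> Ck_on k (\<phi> ` (U \<inter> W)) (f \<circ> inv_into U \<phi>)"
  shows "smooth_fun \<A> W f"
  using assms by (auto simp: smooth_fun_def smooth_on_def)

lemma smooth_funD: "smooth_fun \<A> W f \<Longrightarrow> (U, \<phi>) \<in> \<A> \<Longrightarrow> Ck_on k (\<phi> ` (U \<inter> W)) (f \<circ> inv_into U \<phi>)"
  by (auto simp: smooth_fun_def smooth_on_def)

lemma smooth_fun_cong:
  assumes "smooth_manifold \<A>" "open W" "\<And>x. x \<in> W \<Longrightarrow> f x = h x" "smooth_fun \<A> W f"
  shows "smooth_fun \<A> W h"
proof -
  have "Ck_on k (\<phi> ` (U \<inter> W)) (h \<circ> inv_into U \<phi>)" if c: "(U, \<phi>) \<in> \<A>" for U \<phi> k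
  proof (rule Ck_on_cong)
    show "open (\<phi> ` (U \<inter> W))"
      using open_chart_image smooth_manifold_chart assms(1,2) c by blast
    show "Ck_on k (\<phi> ` (U \<inter> W)) (f \<circ> inv_into U \<phi>)"
      using smooth_funD[OF assms(4) c] .
  qed (use assms(1,3) inv_into_chart[OF smooth_manifold_chart[OF assms(1) c]] in auto)
  then show ?thesis by (rule smooth_funI)
qed

lemma smooth_fun_subset: "smooth_fun \<A> W f \<Longrightarrow> T \<subseteq> W \<Longrightarrow> smooth_fun \<A> T f"
  by (rule smooth_funI, rule Ck_on_subset[OF smooth_funD]) auto

lemma smooth_fun_const: "smooth_fun \<A> W (\<lambda>_. c)"
  by (auto simp: smooth_fun_def smooth_on_def comp_def Ck_on_const)

lemma smooth_fun_add:
  assumes "smooth_manifold \<A>" "open W" "smooth_fun \<A> W f" "smooth_fun \<A> W h"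
  shows "smooth_fun \<A> W (\<lambda>x. f x + h x)"
proof (rule smooth_funI)
  fix U \<phi> k assume c: "(U, \<phi>) \<in> \<A>"
  have "open (\<phi> ` (U \<inter> W))"
    using open_chart_image[OF smooth_manifold_chart[OF assms(1) c] assms(2)] .
  then show "Ck_on k (\<phi> ` (U \<inter> W)) ((\<lambda>x. f x + h x) \<circ> inv_into U \<phi>)"
    using Ck_on_add[OF _ smooth_funD[OF assms(3) c] smooth_funD[OF assms(4) c]] by (simp add: comp_def)
qed

lemma smooth_fun_mult:
  assumes "smooth_manifold \<A>" "open W" "smooth_fun \<A> W f" "smooth_fun \<A> W h"
  shows "smooth_fun \<A> W (\<lambda>x. f x * h x)"
proof (rule smooth_funI)
  fix U \<phi> k assume c: "(U, \<phi>) \<in> \<A>"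
  have "open (\<phi> ` (U \<inter> W))"
    using open_chart_image[OF smooth_manifold_chart[OF assms(1) c] assms(2)] .
  then show "Ck_on k (\<phi> ` (U \<inter> W)) ((\<lambda>x. f x * h x) \<circ> inv_into U \<phi>)"
    using Ck_on_mult[OF _ smooth_funD[OF assms(3) c] smooth_funD[OF assms(4) c]] by (simp add: comp_def)
qed

text \<open>Around each point a target chart \<open>\<psi>\<close> is inserted, so that the local
  expression becomes the composite of that of \<open>f\<close> with that of \<open>F\<close>; as
  \<open>\<psi>\<close> depends on the point, the pieces are joined by
  \<open>Ck_on_local\<close>.\<close>

lemma smooth_fun_compose:
  assumes M: "smooth_manifold \<A>" and N: "smooth_manifold \<B>"
    and F: "smooth_map \<A> \<B> F" and V: "open V" and f: "smooth_fun \<B> V f"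
  shows "smooth_fun \<A> (F -` V) (f \<circ> F)"
proof -
  have oF: "open (F -` T)" if "open T" for T
    using F that by (simp add: smooth_map_def open_vimage)
  have "Ck_on k (\<phi> ` (U \<inter> F -` V)) (f \<circ> F \<circ> inv_into U \<phi>)" if c: "(U, \<phi>) \<in> \<A>" for U \<phi> k
  proof (rule Ck_on_local)
    fix z assume "z \<in> \<phi> ` (U \<inter> F -` V)"
    then obtain y where y: "y \<in> U" "F y \<in> V" "z = \<phi> y" by blast
    obtain V' \<psi> where c': "(V', \<psi>) \<in> \<B>" "F y \<in> V'"
      using N unfolding smooth_manifold_def by blast
    have ch: "chart U \<phi>" "chart V' \<psi>"
      using smooth_manifold_chart[OF M c] smooth_manifold_chart[OF N c'(1)] .
    have oV': "open V'" using ch(2) by (simp add: chart_def)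
    define T where "T = \<phi> ` (U \<inter> F -` (V' \<inter> V))"
    have oT: "open T"
      unfolding T_def using open_chart_image[OF ch(1)] oF oV' V by blast
    have "Ck_on k T (\<lambda>x. (f \<circ> inv_into V' \<psi>) ((\<psi> \<circ> F \<circ> inv_into U \<phi>) x))"
    proof (rule Ck_on_compose[OF oT, where T = "\<psi> ` (V' \<inter> V)"
          and f = "f \<circ> inv_into V' \<psi>" and h = "\<psi> \<circ> F \<circ> inv_into U \<phi>"])
      show "open (\<psi> ` (V' \<inter> V))" using open_chart_image[OF ch(2) V] .
      show "(\<psi> \<circ> F \<circ> inv_into U \<phi>) ` T \<subseteq> \<psi> ` (V' \<inter> V)"
        by (auto simp: T_def inv_into_chart[OF ch(1)])
      show "Ck_on k (\<psi> ` (V' \<inter> V)) (f \<circ> inv_into V' \<psi>)"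
        using smooth_funD[OF f c'(1)] .
      have "Ck_on k (\<phi> ` (U \<inter> F -` V')) (\<psi> \<circ> F \<circ> inv_into U \<phi>)"
        using F c c'(1) unfolding smooth_map_def smooth_on_def by blast
      then show "Ck_on k T (\<psi> \<circ> F \<circ> inv_into U \<phi>)"
        by (rule Ck_on_subset) (auto simp: T_def)
    qed
    then have "Ck_on k T (f \<circ> F \<circ> inv_into U \<phi>)"
      by (rule Ck_on_cong[OF oT, rotated])
        (auto simp: T_def inv_into_chart[OF ch(1)] inv_into_chart[OF ch(2)])
    moreover have "z \<in> T" using y c' by (auto simp: T_def)
    ultimately show "\<exists>T. open T \<and> z \<in> T \<and> Ck_on k T (f \<circ> F \<circ> inv_into U \<phi>)"
      using oT by blast
  qed
  then show ?thesis by (rule smooth_funI)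
qed

lemma smooth_nearI: "open W \<Longrightarrow> p \<in> W \<Longrightarrow> smooth_fun \<A> W f \<Longrightarrow> smooth_near \<A> p f"
  by (auto simp: smooth_near_def)

lemma smooth_near_compose:
  assumes "smooth_manifold \<A>" "smooth_manifold \<B>" "smooth_map \<A> \<B> F" "smooth_near \<B> (F p) f"
  shows "smooth_near \<A> p (f \<circ> F)"
proof -
  obtain W where W: "open W" "F p \<in> W" "smooth_fun \<B> W f"
    using assms(4) by (auto simp: smooth_near_def)
  then have "open (F -` W)" using assms(3) by (simp add: smooth_map_def open_vimage)
  then show ?thesis using smooth_fun_compose[OF assms(1-3) W(1,3)] W(2)
    by (auto intro: smooth_nearI)
qed

section \<open>Tangent vectors and smooth vector fields\<close>

lemma tangent_spaceI:
  assumes "\<And>f. \<not> smooth_near \<A> p f \<Longrightarrow> v f = 0"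
    and "\<And>f h. smooth_near \<A> p f \<Longrightarrow> eventually (\<lambda>x. f x = h x) (nhds p) \<Longrightarrow> v f = v h"
    and "\<And>f h. smooth_near \<A> p f \<Longrightarrow> smooth_near \<A> p h \<Longrightarrow> v (\<lambda>x. f x + h x) = v f + v h"
    and "\<And>f h. smooth_near \<A> p f \<Longrightarrow> smooth_near \<A> p h \<Longrightarrow> v (\<lambda>x. f x * h x) = v f * h p + f p * v h"
    and "\<And>c f. smooth_near \<A> p f \<Longrightarrow> v (\<lambda>x. c * f x) = c * v f"
  shows "v \<in> tangent_space \<A> p"
  unfolding tangent_space_def mem_Collect_eq by (intro conjI allI impI assms)

lemma tangent_spaceD:
  assumes "v \<in> tangent_space \<A> p"
  shows tangent_not_smooth: "\<not> smooth_near \<A> p f \<Longrightarrow> v f = 0"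
    and tangent_cong: "smooth_near \<A> p f \<Longrightarrow> eventually (\<lambda>x. f x = h x) (nhds p) \<Longrightarrow> v f = v h"
    and tangent_add: "smooth_near \<A> p f \<Longrightarrow> smooth_near \<A> p h \<Longrightarrow>
      v (\<lambda>x. f x + h x) = v f + v h"
    and tangent_mult: "smooth_near \<A> p f \<Longrightarrow> smooth_near \<A> p h \<Longrightarrow>
      v (\<lambda>x. f x * h x) = v f * h p + f p * v h"
    and tangent_cmult: "smooth_near \<A> p f \<Longrightarrow> v (\<lambda>x. c * f x) = c * v f"
proof -
  note * = assms[unfolded tangent_space_def mem_Collect_eq]
  note not_smooth = *[THEN conjunct1, rule_format]
    and cong = *[THEN conjunct2, THEN conjunct1, rule_format]
    and add_mult = *[THEN conjunct2, THEN conjunct2, THEN conjunct1, rule_format]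
    and cmult = *[THEN conjunct2, THEN conjunct2, THEN conjunct2, rule_format]
  show "\<not> smooth_near \<A> p f \<Longrightarrow> v f = 0" by (rule not_smooth)
  show "smooth_near \<A> p f \<Longrightarrow> eventually (\<lambda>x. f x = h x) (nhds p) \<Longrightarrow> v f = v h" by (rule cong)
  show "smooth_near \<A> p f \<Longrightarrow> smooth_near \<A> p h \<Longrightarrow> v (\<lambda>x. f x + h x) = v f + v h"
    by (rule add_mult[THEN conjunct1])
  show "smooth_near \<A> p f \<Longrightarrow> smooth_near \<A> p h \<Longrightarrow> v (\<lambda>x. f x * h x) = v f * h p + f p * v h"
    by (rule add_mult[THEN conjunct2])
  show "smooth_near \<A> p f \<Longrightarrow> v (\<lambda>x. c * f x) = c * v f" by (rule cmult)
qed

lemma subspace_tangent_space: "subspace (tangent_space \<A> p)"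
proof (rule subspaceI)
  show "0 \<in> tangent_space \<A> p" by (rule tangent_spaceI) auto
next
  fix v w assume v: "v \<in> tangent_space \<A> p" and w: "w \<in> tangent_space \<A> p"
  show "v + w \<in> tangent_space \<A> p"
  proof (rule tangent_spaceI)
    fix f h assume "smooth_near \<A> p f" "eventually (\<lambda>x. f x = h x) (nhds p)"
    from tangent_cong[OF v this] tangent_cong[OF w this] show "(v + w) f = (v + w) h" by simp
  qed (simp_all add: tangent_not_smooth[OF v] tangent_not_smooth[OF w] tangent_add[OF v]
      tangent_add[OF w] tangent_mult[OF v] tangent_mult[OF w] tangent_cmult[OF v]
      tangent_cmult[OF w] algebra_simps)
next
  fix a v assume v: "v \<in> tangent_space \<A> p"
  show "a *\<^sub>R v \<in> tangent_space \<A> p"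
  proof (rule tangent_spaceI)
    fix f h assume "smooth_near \<A> p f" "eventually (\<lambda>x. f x = h x) (nhds p)"
    from tangent_cong[OF v this] show "(a *\<^sub>R v) f = (a *\<^sub>R v) h" by (simp add: scaleR_fun_def)
  qed (simp_all add: tangent_not_smooth[OF v] tangent_add[OF v] tangent_mult[OF v]
      tangent_cmult[OF v] scaleR_fun_def algebra_simps)
qed

text \<open>The Leibniz rule for \<open>1 = 1 * 1\<close> gives
  \<open>v 1 = 2 * v 1\<close>.\<close>

lemma tangent_const:
  assumes "v \<in> tangent_space \<A> p"
  shows "v (\<lambda>_. c) = 0"
proof -
  have 1: "smooth_near \<A> p (\<lambda>_. c)" for c
    by (auto simp: smooth_near_def intro!: exI[of _ UNIV] smooth_fun_const)
  have "v (\<lambda>_. 1) = 0" using tangent_mult[OF assms 1 1, of 1 1] by simp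
  then show ?thesis using tangent_cmult[OF assms 1, of c 1] by simp
qed

lemma vfieldsI:
  assumes "\<And>p. p \<in> U \<Longrightarrow> X p \<in> tangent_space \<A> p"
    and "\<And>W f. open W \<Longrightarrow> W \<subseteq> U \<Longrightarrow> smooth_fun \<A> W f \<Longrightarrow> smooth_fun \<A> W (\<lambda>p. X p f)"
  shows "X \<in> vfields \<A> U"
  using assms by (simp add: vfields_def)

lemma vfieldsD:
  assumes "X \<in> vfields \<A> U"
  shows vfields_tangent: "p \<in> U \<Longrightarrow> X p \<in> tangent_space \<A> p"
    and vfields_smooth: "open W \<Longrightarrow> W \<subseteq> U \<Longrightarrow> smooth_fun \<A> W f \<Longrightarrow> smooth_fun \<A> W (\<lambda>p. X p f)"
  using assms by (simp_all add: vfields_def)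

lemma vfields_cong:
  assumes M: "smooth_manifold \<A>" and eq: "\<And>x. x \<in> U \<Longrightarrow> X x = Y x" and X: "X \<in> vfields \<A> U"
  shows "Y \<in> vfields \<A> U"
proof (rule vfieldsI)
  show "Y x \<in> tangent_space \<A> x" if "x \<in> U" for x
    using vfields_tangent[OF X that] eq[OF that] by simp
  show "smooth_fun \<A> W (\<lambda>p. Y p f)" if W: "open W" "W \<subseteq> U" "smooth_fun \<A> W f" for W f
    by (rule smooth_fun_cong[OF M W(1) _ vfields_smooth[OF X W]]) (use W(2) eq in auto)
qed

lemma vfields_subset: "X \<in> vfields \<A> U \<Longrightarrow> T \<subseteq> U \<Longrightarrow> X \<in> vfields \<A> T"
  by (auto simp: vfields_def)

lemma vfields_add:
  assumes M: "smooth_manifold \<A>" and X: "X \<in> vfields \<A> U" and Y: "Y \<in> vfields \<A> U"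
  shows "(\<lambda>x. X x + Y x) \<in> vfields \<A> U"
proof (rule vfieldsI)
  show "X x + Y x \<in> tangent_space \<A> x" if "x \<in> U" for x
    using subspace_add[OF subspace_tangent_space vfields_tangent[OF X that] vfields_tangent[OF Y that]] .
  show "smooth_fun \<A> W (\<lambda>p. (X p + Y p) f)" if "open W" "W \<subseteq> U" "smooth_fun \<A> W f" for W f
    using smooth_fun_add[OF M that(1) vfields_smooth[OF X that] vfields_smooth[OF Y that]] by simp
qed

lemma vfields_scale:
  assumes M: "smooth_manifold \<A>" and h: "smooth_fun \<A> U h" and X: "X \<in> vfields \<A> U"
  shows "(\<lambda>x. h x *\<^sub>R X x) \<in> vfields \<A> U"
proof (rule vfieldsI)
  show "h x *\<^sub>R X x \<in> tangent_space \<A> x" if "x \<in> U" for x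
    using subspace_scale[OF subspace_tangent_space vfields_tangent[OF X that]] .
  show "smooth_fun \<A> W (\<lambda>p. (h p *\<^sub>R X p) f)" if "open W" "W \<subseteq> U" "smooth_fun \<A> W f" for W f
    using smooth_fun_mult[OF M that(1) smooth_fun_subset[OF h that(2)] vfields_smooth[OF X that]]
    by (simp add: scaleR_fun_def)
qed

lemma vfields_0: "smooth_manifold \<A> \<Longrightarrow> (\<lambda>_. 0) \<in> vfields \<A> U"
  by (rule vfieldsI) (simp_all add: subspace_0[OF subspace_tangent_space] smooth_fun_const)

lemma vfields_sum:
  assumes "smooth_manifold \<A>" "\<And>i. i \<in> I \<Longrightarrow> X i \<in> vfields \<A> U"
  shows "(\<lambda>x. \<Sum>i\<in>I. X i x) \<in> vfields \<A> U"
  using assms(2)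
  by (induction I rule: infinite_finite_induct)
    (simp_all add: vfields_0[OF assms(1)] vfields_add[OF assms(1)])

text \<open>The basis in \<open>trace_on\<close> is an arbitrary choice. Expanding each of its
  vectors in the family \<open>u\<close> and exchanging the two sums reassembles
  \<open>T (u i)\<close> from its representation in that basis, so the choice disappears. In the
  application \<open>c i\<close> is the inner product with the frame vector
  \<open>u i\<close>.\<close>

lemma trace_on_eq:
  fixes T :: "'v::real_vector \<Rightarrow> 'v"
  assumes V: "subspace V" and I: "finite I" and u: "\<And>i. i \<in> I \<Longrightarrow> u i \<in> V"
    and exp: "\<And>v. v \<in> V \<Longrightarrow> v = (\<Sum>i\<in>I. c i v *\<^sub>R u i)"
    and c: "\<And>i v w. i \<in> I \<Longrightarrow> v \<in> V \<Longrightarrow> w \<in> V \<Longrightarrow> c i (v + w) = c i v + c i w"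
      "\<And>i a v. i \<in> I \<Longrightarrow> v \<in> V \<Longrightarrow> c i (a *\<^sub>R v) = a * c i v"
    and T: "\<And>v. v \<in> V \<Longrightarrow> T v \<in> V" "\<And>v. v \<in> V \<Longrightarrow> T v = (\<Sum>i\<in>I. c i v *\<^sub>R T (u i))"
  shows "trace_on V T = (\<Sum>i\<in>I. c i (T (u i)))"
proof -
  define B where "B = (SOME B. B \<subseteq> V \<and> independent B \<and> V \<subseteq> span B)"
  have "\<exists>B. B \<subseteq> V \<and> independent B \<and> V \<subseteq> span B"
    by (meson maximal_independent_subset)
  then have B: "B \<subseteq> V" "independent B" "V \<subseteq> span B"
    unfolding B_def by (metis (mono_tags, lifting) someI_ex)+
  have "B \<subseteq> span (u ` I)"
  proof
    fix b assume "b \<in> B"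
    then have "b = (\<Sum>i\<in>I. c i b *\<^sub>R u i)" using exp B by blast
    also have "\<dots> \<in> span (u ` I)" by (intro span_sum span_scale span_base imageI)
    finally show "b \<in> span (u ` I)" .
  qed
  then have fB: "finite B" using independent_span_bound[OF _ B(2)] I by blast
  have c_sum: "c i (\<Sum>b\<in>S. f b *\<^sub>R b) = (\<Sum>b\<in>S. f b * c i b)"
    if "i \<in> I" "finite S" "S \<subseteq> V" for i S f
    using that(2,3)
  proof (induction S)
    case empty
    have "c i 0 = 0" using c(2)[OF that(1), of 0 0] subspace_0[OF V] by simp
    then show ?case by simp
  next
    case (insert b S)
    have "(\<Sum>b\<in>S. f b *\<^sub>R b) \<in> V" "f b *\<^sub>R b \<in> V"
      using insert.prems by (auto intro!: subspace_sum V subspace_scale)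
    then show ?case using insert c[OF that(1)] by simp
  qed
  have rep: "representation B (T b) b = (\<Sum>i\<in>I. c i b * representation B (T (u i)) b)"
    if "b \<in> B" for b
  proof -
    have "b \<in> V" using that B by blast
    then have "representation B (T b) = representation B (\<Sum>i\<in>I. c i b *\<^sub>R T (u i))"
      using T(2) by metis
    also have "\<dots> = (\<lambda>b'. \<Sum>i\<in>I. representation B (c i b *\<^sub>R T (u i)) b')"
      by (rule representation_sum) (use B T u in \<open>auto intro!: span_scale\<close>)
    also have "\<dots> = (\<lambda>b'. \<Sum>i\<in>I. c i b * representation B (T (u i)) b')"
    proof -
      have "representation B (c i b *\<^sub>R T (u i)) = (\<lambda>b'. c i b * representation B (T (u i)) b')"
        if "i \<in> I" for i
        by (rule representation_scale) (use B T u that in auto)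
      then show ?thesis by (auto simp: fun_eq_iff intro!: sum.cong)
    qed
    finally show ?thesis by simp
  qed
  have "trace_on V T = (\<Sum>b\<in>B. representation B (T b) b)"
    by (simp add: trace_on_def B_def Let_def)
  also have "\<dots> = (\<Sum>i\<in>I. \<Sum>b\<in>B. c i b * representation B (T (u i)) b)"
    by (subst sum.swap) (simp add: rep)
  also have "\<dots> = (\<Sum>i\<in>I. c i (\<Sum>b\<in>B. representation B (T (u i)) b *\<^sub>R b))"
    by (intro sum.cong refl) (simp add: c_sum fB B mult.commute)
  also have "\<dots> = (\<Sum>i\<in>I. c i (T (u i)))"
  proof (intro sum.cong refl)
    fix i assume "i \<in> I"
    have "(\<Sum>b\<in>B. representation B (T (u i)) b *\<^sub>R b) = T (u i)"
      by (rule sum_representation_eq) (use B T u \<open>i \<in> I\<close> fB in auto)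
    then show "c i (\<Sum>b\<in>B. representation B (T (u i)) b *\<^sub>R b) = c i (T (u i))" by simp
  qed
  finally show ?thesis .
qed

section \<open>Curvature and frames\<close>

text \<open>The simplifier applies these rules also to functions without argument and would turn a sum of tangent
  vectors into an abstraction.\<close>

declare plus_fun_apply [simp del] zero_fun_apply [simp del] minus_apply [simp del] uminus_apply [simp del]

lemma cov_apply: "cov nab X Y p = nab p (X p) Y"
  by (simp add: cov_def)

text \<open>What is recorded of an orthonormal frame is its expansion formula, which yields both
  tensoriality and the coordinate functionals for the trace. The index type is left open because the
  frames of the two distributions are later joined over the disjoint sum
  \<open>I <+> J\<close>.\<close>

definition full_frame ::
  "('a::topological_space, 'e::euclidean_space) atlas \<Rightarrow> 'a metric_tensor \<Rightarrow> 'a set \<Rightarrow>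
   'i set \<Rightarrow> ('i \<Rightarrow> 'a vfield) \<Rightarrow> bool" where
  "full_frame \<A> g U I E \<longleftrightarrow> finite I \<and> (\<forall>i\<in>I. E i \<in> vfields \<A> U) \<and>
     (\<forall>x\<in>U. \<forall>v\<in>tangent_space \<A> x. v = (\<Sum>i\<in>I. g x v (E i x) *\<^sub>R E i x))"

lemma full_frame_subset: "full_frame \<A> g U I E \<Longrightarrow> W \<subseteq> U \<Longrightarrow> full_frame \<A> g W I E"
  unfolding full_frame_def by (meson subsetD vfields_subset)

locale riemannian_open =
  fixes \<A> :: "('a::{t2_space,second_countable_topology}, 'e::euclidean_space) atlas"
    and g :: "'a metric_tensor" and nab :: "'a conn" and U :: "'a set"
  assumes manifold: "smooth_manifold \<A>" and metric: "riemannian_metric \<A> g"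
    and connection: "levi_civita \<A> g nab" and open_U: "open U"
begin

abbreviation "T \<equiv> tangent_space \<A>"
abbreviation "VF \<equiv> vfields \<A> U"
abbreviation "CF \<equiv> smooth_fun \<A> U"

lemmas T_add = subspace_add[OF subspace_tangent_space[of \<A>]]
  and T_diff = subspace_diff[OF subspace_tangent_space[of \<A>]]
  and T_scale = subspace_scale[OF subspace_tangent_space[of \<A>]]
  and T_minus = subspace_neg[OF subspace_tangent_space[of \<A>]]
  and T_0 = subspace_0[OF subspace_tangent_space[of \<A>]]
  and T_sum = subspace_sum[OF subspace_tangent_space[of \<A>]]

lemma g_sym: "u \<in> T p \<Longrightarrow> v \<in> T p \<Longrightarrow> g p u v = g p v u"
  using metric unfolding riemannian_metric_def by blast

lemma g_pos: "u \<in> T p \<Longrightarrow> u \<noteq> 0 \<Longrightarrow> g p u u > 0"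
  using metric unfolding riemannian_metric_def by blast

lemma g_add_left: "u \<in> T p \<Longrightarrow> v \<in> T p \<Longrightarrow> w \<in> T p \<Longrightarrow> g p (u + v) w = g p u w + g p v w"
  using metric unfolding riemannian_metric_def by blast

lemma g_scale_left: "u \<in> T p \<Longrightarrow> w \<in> T p \<Longrightarrow> g p (c *\<^sub>R u) w = c * g p u w"
  using metric unfolding riemannian_metric_def by blast

lemma g_smooth: "X \<in> VF \<Longrightarrow> Y \<in> VF \<Longrightarrow> CF (\<lambda>p. g p (X p) (Y p))"
  using metric open_U unfolding riemannian_metric_def by blast

lemma g_add_right: "u \<in> T p \<Longrightarrow> v \<in> T p \<Longrightarrow> w \<in> T p \<Longrightarrow> g p w (u + v) = g p w u + g p w v"
  using g_add_left[of u p v w] by (simp add: g_sym[of w] T_add)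

lemma g_scale_right: "u \<in> T p \<Longrightarrow> w \<in> T p \<Longrightarrow> g p w (c *\<^sub>R u) = c * g p w u"
  using g_scale_left[of u p w] by (simp add: g_sym[of w] T_scale)

lemma g_minus_left: "u \<in> T p \<Longrightarrow> w \<in> T p \<Longrightarrow> g p (- u) w = - g p u w"
  using g_scale_left[of u p w "-1"] by simp

lemma g_minus_right: "u \<in> T p \<Longrightarrow> w \<in> T p \<Longrightarrow> g p w (- u) = - g p w u"
  using g_scale_right[of u p w "-1"] by simp

lemma g_diff_left: "u \<in> T p \<Longrightarrow> v \<in> T p \<Longrightarrow> w \<in> T p \<Longrightarrow> g p (u - v) w = g p u w - g p v w"
  using g_add_left[of u p "- v" w] by (simp add: g_minus_left T_minus)

lemma g_diff_right: "u \<in> T p \<Longrightarrow> v \<in> T p \<Longrightarrow> w \<in> T p \<Longrightarrow> g p w (u - v) = g p w u - g p w v"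
  using g_add_right[of u p "- v" w] by (simp add: g_minus_right T_minus)

lemma g_0_left: "w \<in> T p \<Longrightarrow> g p 0 w = 0"
  using g_scale_left[OF T_0, of w p 0] by simp

lemma g_sum_left:
  assumes "w \<in> T p" "\<And>i. i \<in> I \<Longrightarrow> u i \<in> T p"
  shows "g p (\<Sum>i\<in>I. u i) w = (\<Sum>i\<in>I. g p (u i) w)"
  using assms(2)
  by (induction I rule: infinite_finite_induct) (simp_all add: g_0_left assms(1) g_add_left T_sum)

lemma g_nondegenerate:
  assumes "u \<in> T p" "\<And>w. w \<in> T p \<Longrightarrow> g p u w = 0"
  shows "u = 0"
  using assms g_pos by force

lemma VF_T: "X \<in> VF \<Longrightarrow> p \<in> U \<Longrightarrow> X p \<in> T p"
  by (rule vfields_tangent)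

lemma VF_smooth: "X \<in> VF \<Longrightarrow> CF f \<Longrightarrow> CF (\<lambda>p. X p f)"
  using vfields_smooth[OF _ open_U order_refl] .

lemmas VF_add = vfields_add[OF manifold] and VF_scale = vfields_scale[OF manifold]
  and VF_cong = vfields_cong[OF manifold] and VF_sum = vfields_sum[OF manifold]
  and VF_0 = vfields_0[OF manifold]

lemma VF_minus: "X \<in> VF \<Longrightarrow> (\<lambda>x. - X x) \<in> VF"
  using VF_scale[OF smooth_fun_const, of X U "-1"] by simp

lemma VF_diff: "X \<in> VF \<Longrightarrow> Y \<in> VF \<Longrightarrow> (\<lambda>x. X x - Y x) \<in> VF"
  using VF_add[OF _ VF_minus, of X Y] by simp

lemma CF_near: "CF f \<Longrightarrow> p \<in> U \<Longrightarrow> smooth_near \<A> p f"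
  using smooth_nearI[OF open_U] .

lemma derivation_add: "v \<in> T p \<Longrightarrow> p \<in> U \<Longrightarrow> CF f \<Longrightarrow> CF h \<Longrightarrow> v (\<lambda>x. f x + h x) = v f + v h"
  by (simp add: tangent_add CF_near)

lemma derivation_cong:
  assumes "v \<in> T p" "p \<in> U" "CF f" "\<And>x. x \<in> U \<Longrightarrow> f x = h x"
  shows "v f = v h"
  by (rule tangent_cong[OF assms(1) CF_near[OF assms(3,2)]])
    (use assms open_U eventually_nhds in blast)

lemma affine: "affine_connection \<A> nab"
  using connection by (simp add: levi_civita_def)

lemma cov_VF: "X \<in> VF \<Longrightarrow> Y \<in> VF \<Longrightarrow> cov nab X Y \<in> VF"
  using affine open_U unfolding affine_connection_def by blast

context
  fixes p v Y
  assumes p: "p \<in> U" and v: "v \<in> T p" and Y: "Y \<in> VF"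
begin

lemma affine_at: "nab p v Y \<in> T p \<and>
        (\<forall>Z\<in>VF. (\<forall>x\<in>U. Z x = Y x) \<longrightarrow> nab p v Z = nab p v Y) \<and>
        (\<forall>w\<in>T p. nab p (v + w) Y = nab p v Y + nab p w Y) \<and>
        (\<forall>c. nab p (c *\<^sub>R v) Y = c *\<^sub>R nab p v Y) \<and>
        (\<forall>Z\<in>VF. nab p v (\<lambda>x. Y x + Z x) = nab p v Y + nab p v Z) \<and>
        (\<forall>f. CF f \<longrightarrow> nab p v (\<lambda>x. f x *\<^sub>R Y x) = v f *\<^sub>R Y p + f p *\<^sub>R nab p v Y)"
  using affine[unfolded affine_connection_def, rule_format, OF open_U, THEN conjunct2,
      rule_format, OF p Y v] .

lemma nab_T: "nab p v Y \<in> T p"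
  using affine_at by (elim conjE)

lemma nab_cong: "Z \<in> VF \<Longrightarrow> (\<And>x. x \<in> U \<Longrightarrow> Z x = Y x) \<Longrightarrow> nab p v Z = nab p v Y"
  using affine_at by (elim conjE) blast

lemma nab_add_dir: "w \<in> T p \<Longrightarrow> nab p (v + w) Y = nab p v Y + nab p w Y"
  using affine_at by (elim conjE) blast

lemma nab_scale_dir: "nab p (c *\<^sub>R v) Y = c *\<^sub>R nab p v Y"
  using affine_at by (elim conjE) blast

lemma nab_add: "Z \<in> VF \<Longrightarrow> nab p v (\<lambda>x. Y x + Z x) = nab p v Y + nab p v Z"
  using affine_at by (elim conjE) blast

lemma nab_scale: "CF f \<Longrightarrow> nab p v (\<lambda>x. f x *\<^sub>R Y x) = v f *\<^sub>R Y p + f p *\<^sub>R nab p v Y"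
  using affine_at by (elim conjE) blast

lemma nab_minus: "nab p v (\<lambda>x. - Y x) = - nab p v Y"
  using nab_scale[OF smooth_fun_const, of "-1"] tangent_const[OF v] by simp

lemma nab_minus_dir: "nab p (- v) Y = - nab p v Y"
  using nab_scale_dir[of "-1"] by simp

end

lemma nab_diff_dir:
  "p \<in> U \<Longrightarrow> v \<in> T p \<Longrightarrow> w \<in> T p \<Longrightarrow> Y \<in> VF \<Longrightarrow> nab p (v - w) Y = nab p v Y - nab p w Y"
  using nab_add_dir[of p v Y "- w"] nab_minus_dir[of p w Y] by (simp add: T_minus)

lemma nab_diff:
  "p \<in> U \<Longrightarrow> v \<in> T p \<Longrightarrow> Y \<in> VF \<Longrightarrow> Z \<in> VF \<Longrightarrow> nab p v (\<lambda>x. Y x - Z x) = nab p v Y - nab p v Z"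
  using nab_add[of p v Y "\<lambda>x. - Z x"] nab_minus[of p v Z] by (simp add: VF_minus)

lemma torsion_free:
  "X \<in> VF \<Longrightarrow> Y \<in> VF \<Longrightarrow> p \<in> U \<Longrightarrow> nab p (X p) Y - nab p (Y p) X = lie_bracket \<A> X Y p"
  using connection open_U unfolding levi_civita_def cov_def by blast

lemma metric_compatible:
  "X \<in> VF \<Longrightarrow> Y \<in> VF \<Longrightarrow> Z \<in> VF \<Longrightarrow> p \<in> U \<Longrightarrow>
    X p (\<lambda>x. g x (Y x) (Z x)) = g p (nab p (X p) Y) (Z p) + g p (Y p) (nab p (X p) Z)"
  using connection open_U unfolding levi_civita_def cov_def by blast

section \<open>Curvature and its tensoriality\<close>

lemma lie_VF:
  assumes X: "X \<in> VF" and Y: "Y \<in> VF"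
  shows "lie_bracket \<A> X Y \<in> VF"
  by (rule VF_cong[OF _ VF_diff[OF cov_VF[OF X Y] cov_VF[OF Y X]]])
    (simp add: cov_def torsion_free X Y)

text \<open>Torsion-freeness removes the Lie bracket, so that the algebraic rules of
  \<open>nab\<close> suffice for all later computations.\<close>

lemma curvature_eq:
  assumes "X \<in> VF" "Y \<in> VF" "p \<in> U" "Z \<in> VF"
  shows "curvature \<A> nab X Y Z p = nab p (X p) (cov nab Y Z) - nab p (Y p) (cov nab X Z)
    - nab p (nab p (X p) Y) Z + nab p (nab p (Y p) X) Z"
  using assms by (simp add: curvature_def cov_def torsion_free[symmetric] nab_diff_dir nab_T VF_T)

lemma curvature_T: "X \<in> VF \<Longrightarrow> Y \<in> VF \<Longrightarrow> Z \<in> VF \<Longrightarrow> p \<in> U \<Longrightarrow> curvature \<A> nab X Y Z p \<in> T p"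
  by (simp add: curvature_def cov_VF lie_VF VF_T T_diff)

text \<open>Linearity over the smooth functions on \<open>U\<close>, with values at the one point
  \<open>p\<close>. The last clause is a separate requirement because fields are total functions:
  two of them may agree on \<open>U\<close> and differ outside.\<close>

definition tensorial :: "'a \<Rightarrow> ('a vfield \<Rightarrow> 'a tangent) \<Rightarrow> bool" where
  "tensorial p \<Phi> \<longleftrightarrow> (\<forall>X\<in>VF. \<forall>Y\<in>VF. \<Phi> (\<lambda>x. X x + Y x) = \<Phi> X + \<Phi> Y) \<and>
     (\<forall>X\<in>VF. \<forall>f. CF f \<longrightarrow> \<Phi> (\<lambda>x. f x *\<^sub>R X x) = f p *\<^sub>R \<Phi> X) \<and>
     (\<forall>X\<in>VF. \<forall>Y\<in>VF. (\<forall>x\<in>U. X x = Y x) \<longrightarrow> \<Phi> X = \<Phi> Y)"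

lemma tensorialI:
  assumes "\<And>X Y. X \<in> VF \<Longrightarrow> Y \<in> VF \<Longrightarrow> \<Phi> (\<lambda>x. X x + Y x) = \<Phi> X + \<Phi> Y"
    and "\<And>X f. X \<in> VF \<Longrightarrow> CF f \<Longrightarrow> \<Phi> (\<lambda>x. f x *\<^sub>R X x) = f p *\<^sub>R \<Phi> X"
    and "\<And>X Y. X \<in> VF \<Longrightarrow> Y \<in> VF \<Longrightarrow> (\<And>x. x \<in> U \<Longrightarrow> X x = Y x) \<Longrightarrow> \<Phi> X = \<Phi> Y"
  shows "tensorial p \<Phi>"
  unfolding tensorial_def by (intro conjI ballI allI impI assms) auto

lemma tensorialD:
  assumes "tensorial p \<Phi>" "X \<in> VF"
  shows tensorial_add: "Y \<in> VF \<Longrightarrow> \<Phi> (\<lambda>x. X x + Y x) = \<Phi> X + \<Phi> Y"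
    and tensorial_scale: "CF f \<Longrightarrow> \<Phi> (\<lambda>x. f x *\<^sub>R X x) = f p *\<^sub>R \<Phi> X"
    and tensorial_cong: "Y \<in> VF \<Longrightarrow> (\<And>x. x \<in> U \<Longrightarrow> X x = Y x) \<Longrightarrow> \<Phi> X = \<Phi> Y"
proof -
  note * = assms(1)[unfolded tensorial_def]
  show "Y \<in> VF \<Longrightarrow> \<Phi> (\<lambda>x. X x + Y x) = \<Phi> X + \<Phi> Y"
    by (rule *[THEN conjunct1, rule_format, OF assms(2)])
  show "CF f \<Longrightarrow> \<Phi> (\<lambda>x. f x *\<^sub>R X x) = f p *\<^sub>R \<Phi> X"
    by (rule *[THEN conjunct2, THEN conjunct1, rule_format, OF assms(2)])
  show "Y \<in> VF \<Longrightarrow> (\<And>x. x \<in> U \<Longrightarrow> X x = Y x) \<Longrightarrow> \<Phi> X = \<Phi> Y"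
    by (rule *[THEN conjunct2, THEN conjunct2, rule_format, OF assms(2)])
qed

lemma tensorial_sum:
  assumes t: "tensorial p \<Phi>" and "finite I" "\<And>i. i \<in> I \<Longrightarrow> E i \<in> VF" "\<And>i. i \<in> I \<Longrightarrow> CF (c i)"
  shows "\<Phi> (\<lambda>x. \<Sum>i\<in>I. c i x *\<^sub>R E i x) = (\<Sum>i\<in>I. c i p *\<^sub>R \<Phi> (E i))"
  using assms(2-)
proof (induction I)
  case empty
  have "\<Phi> (\<lambda>_. 0) = 0"
    using tensorial_scale[OF t VF_0 smooth_fun_const, of 0] by simp
  then show ?case by (simp only: sum.empty)
next
  case (insert i I)
  have "(\<lambda>x. \<Sum>i\<in>I. c i x *\<^sub>R E i x) \<in> VF"
    using insert.prems by (intro VF_sum VF_scale) auto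
  then show ?case
    using insert by (simp add: tensorial_add[OF t] tensorial_scale[OF t] VF_scale)
qed

text \<open>The frame and the coefficients \<open>g x (X x) (E i x)\<close> are smooth on all of
  \<open>U\<close>, so \<open>X\<close> itself is a smooth combination of the frame. This takes the
  place of the usual argument with cutoff functions.\<close>

lemma tensorial_expand:
  assumes t: "tensorial p \<Phi>" and E: "full_frame \<A> g U I E" and X: "X \<in> VF"
  shows "\<Phi> X = (\<Sum>i\<in>I. g p (X p) (E i p) *\<^sub>R \<Phi> (E i))"
proof -
  have fin: "finite I" and VF: "\<And>i. i \<in> I \<Longrightarrow> E i \<in> VF"
    and exp: "\<And>x v. x \<in> U \<Longrightarrow> v \<in> T x \<Longrightarrow> v = (\<Sum>i\<in>I. g x v (E i x) *\<^sub>R E i x)"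
    using E unfolding full_frame_def by blast+
  have "\<Phi> X = \<Phi> (\<lambda>x. \<Sum>i\<in>I. g x (X x) (E i x) *\<^sub>R E i x)"
    using exp VF_T[OF X]
    by (intro tensorial_cong[OF t X] VF_sum VF_scale g_smooth X VF) auto
  also have "\<dots> = (\<Sum>i\<in>I. g p (X p) (E i p) *\<^sub>R \<Phi> (E i))"
    by (rule tensorial_sum[OF t fin VF g_smooth[OF X VF]])
  finally show ?thesis .
qed

lemma tensorial_pointwise:
  assumes "tensorial p \<Phi>" "full_frame \<A> g U I E" "X \<in> VF" "Y \<in> VF" "X p = Y p"
  shows "\<Phi> X = \<Phi> Y"
  using assms(5) by (simp add: tensorial_expand[OF assms(1,2,3)] tensorial_expand[OF assms(1,2,4)])

lemma cov_cong:
  assumes "X \<in> VF" "X' \<in> VF" "Y \<in> VF" "Y' \<in> VF" "x \<in> U"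
    and "\<And>x. x \<in> U \<Longrightarrow> X x = X' x" "\<And>x. x \<in> U \<Longrightarrow> Y x = Y' x"
  shows "cov nab X Y x = cov nab X' Y' x"
  using assms nab_cong[of x "X x" Y' Y] by (simp add: cov_def VF_T)

context
  fixes p assumes p: "p \<in> U"
begin

lemma curvature_tensorial1:
  assumes Y: "Y \<in> VF" and Z: "Z \<in> VF"
  shows "tensorial p (\<lambda>X. curvature \<A> nab X Y Z p)"
proof (rule tensorialI)
  fix X X' assume X: "X \<in> VF" "X' \<in> VF"
  have "nab p (Y p) (cov nab (\<lambda>x. X x + X' x) Z) = nab p (Y p) (\<lambda>x. cov nab X Z x + cov nab X' Z x)"
    by (rule nab_cong) (use X Y Z p in \<open>auto simp: cov_def nab_add_dir VF_T
        intro: VF_T cov_VF[unfolded cov_def] VF_add[OF cov_VF cov_VF, unfolded cov_def] VF_add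
          cov_VF[OF VF_add, unfolded cov_def]\<close>)
  then show "curvature \<A> nab (\<lambda>x. X x + X' x) Y Z p = curvature \<A> nab X Y Z p + curvature \<A> nab X' Y Z p"
    using X Y Z p by (simp add: curvature_eq VF_add nab_add_dir nab_add nab_T VF_T cov_VF)
next
  fix X f assume X: "X \<in> VF" "CF f"
  have "nab p (Y p) (cov nab (\<lambda>x. f x *\<^sub>R X x) Z) = nab p (Y p) (\<lambda>x. f x *\<^sub>R cov nab X Z x)"
    by (rule nab_cong) (use X Y Z p in \<open>auto simp: cov_def nab_scale_dir VF_T
        intro: VF_T cov_VF[OF VF_scale, unfolded cov_def] VF_scale[OF _ cov_VF, unfolded cov_def]\<close>)
  then show "curvature \<A> nab (\<lambda>x. f x *\<^sub>R X x) Y Z p = f p *\<^sub>R curvature \<A> nab X Y Z p"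
    using X Y Z p
    by (simp add: curvature_eq VF_scale nab_scale_dir nab_scale nab_add_dir nab_T T_scale VF_T cov_VF
        cov_apply[of nab X Z p] algebra_simps)
next
  fix X X' assume X: "X \<in> VF" "X' \<in> VF" "\<And>x. x \<in> U \<Longrightarrow> X x = X' x"
  have "nab p (Y p) (cov nab X Z) = nab p (Y p) (cov nab X' Z)" "nab p (Y p) X = nab p (Y p) X'"
    using X Y Z p by (auto intro!: nab_cong VF_T cov_VF cov_cong)
  then show "curvature \<A> nab X Y Z p = curvature \<A> nab X' Y Z p"
    using X Y Z p by (simp add: curvature_eq)
qed

lemma curvature_swap:
  assumes "X \<in> VF" "Y \<in> VF" "Z \<in> VF"
  shows "curvature \<A> nab X Y Z p = - curvature \<A> nab Y X Z p"
  using assms p by (simp add: curvature_eq)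

lemma curvature_tensorial2:
  assumes "X \<in> VF" "Z \<in> VF"
  shows "tensorial p (\<lambda>Y. curvature \<A> nab X Y Z p)"
proof -
  note t = curvature_tensorial1[OF assms]
  show ?thesis
  proof (rule tensorialI)
    fix Y Y' assume Y: "Y \<in> VF" "Y' \<in> VF"
    show "curvature \<A> nab X (\<lambda>x. Y x + Y' x) Z p = curvature \<A> nab X Y Z p + curvature \<A> nab X Y' Z p"
      using tensorial_add[OF t Y] assms Y VF_add by (simp add: curvature_swap[of X])
  next
    fix Y f assume Y: "Y \<in> VF" "CF f"
    show "curvature \<A> nab X (\<lambda>x. f x *\<^sub>R Y x) Z p = f p *\<^sub>R curvature \<A> nab X Y Z p"
      using tensorial_scale[OF t Y] assms Y VF_scale by (simp add: curvature_swap[of X])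
  next
    fix Y Y' assume Y: "Y \<in> VF" "Y' \<in> VF" "\<And>x. x \<in> U \<Longrightarrow> Y x = Y' x"
    show "curvature \<A> nab X Y Z p = curvature \<A> nab X Y' Z p"
      using tensorial_cong[OF t Y] assms Y by (simp add: curvature_swap[of X])
  qed
qed

lemma curvature_tensorial3:
  assumes X: "X \<in> VF" and Y: "Y \<in> VF"
  shows "tensorial p (\<lambda>Z. curvature \<A> nab X Y Z p)"
proof (rule tensorialI)
  fix Z Z' assume Z: "Z \<in> VF" "Z' \<in> VF"
  have "nab p v (cov nab W (\<lambda>x. Z x + Z' x)) = nab p v (\<lambda>x. cov nab W Z x + cov nab W Z' x)"
    if "v \<in> T p" "W \<in> VF" for v W
    by (rule nab_cong) (use Z p that in \<open>auto simp: cov_def nab_add VF_T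
        intro: cov_VF[OF _ VF_add, unfolded cov_def] VF_add[OF cov_VF cov_VF, unfolded cov_def]\<close>)
  then show "curvature \<A> nab X Y (\<lambda>x. Z x + Z' x) p = curvature \<A> nab X Y Z p + curvature \<A> nab X Y Z' p"
    using X Y Z p by (simp add: curvature_eq VF_add nab_add nab_T VF_T cov_VF)
next
  fix Z f assume Z: "Z \<in> VF" "CF f"
  \<comment> \<open>For \<open>v = X p\<close>, \<open>W = Y\<close> and for \<open>v = Y p\<close>,
    \<open>W = X\<close> the two middle terms together give the same sum, so they cancel in the
    curvature.\<close>
  have *: "nab p v (cov nab W (\<lambda>x. f x *\<^sub>R Z x))
      = v (\<lambda>x. W x f) *\<^sub>R Z p + W p f *\<^sub>R nab p v Z + v f *\<^sub>R nab p (W p) Z + f p *\<^sub>R nab p v (cov nab W Z)"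
    if "v \<in> T p" "W \<in> VF" for v W
  proof -
    have Wf: "CF (\<lambda>x. W x f)" using VF_smooth[OF that(2) Z(2)] .
    have "nab p v (cov nab W (\<lambda>x. f x *\<^sub>R Z x)) = nab p v (\<lambda>x. W x f *\<^sub>R Z x + f x *\<^sub>R cov nab W Z x)"
    proof (rule nab_cong[OF p that(1)])
      show "(\<lambda>x. W x f *\<^sub>R Z x + f x *\<^sub>R cov nab W Z x) \<in> VF"
        by (intro VF_add VF_scale cov_VF Wf Z that)
      show "cov nab W (\<lambda>x. f x *\<^sub>R Z x) \<in> VF"
        by (intro VF_scale cov_VF Z that)
      show "cov nab W (\<lambda>x. f x *\<^sub>R Z x) x = W x f *\<^sub>R Z x + f x *\<^sub>R cov nab W Z x" if "x \<in> U" for x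
        using Z \<open>W \<in> VF\<close> that by (simp add: cov_apply nab_scale VF_T)
    qed
    also have "\<dots> = nab p v (\<lambda>x. W x f *\<^sub>R Z x) + nab p v (\<lambda>x. f x *\<^sub>R cov nab W Z x)"
      by (intro nab_add[OF p] VF_scale cov_VF Wf Z that)
    finally show ?thesis
      using Z that p by (simp add: nab_scale Wf cov_VF cov_apply[of nab W Z p])
  qed
  \<comment> \<open>Torsion-freeness as an identity of derivations applied to \<open>f\<close>; it
    cancels the second derivatives of \<open>f\<close> that remain.\<close>
  have lie: "(nab p (X p) Y - nab p (Y p) X) f = X p (\<lambda>x. Y x f) - Y p (\<lambda>x. X x f)"
    using torsion_free[OF X Y p] Z p by (simp add: lie_bracket_def CF_near)
  have "curvature \<A> nab X Y (\<lambda>x. f x *\<^sub>R Z x) p - f p *\<^sub>R curvature \<A> nab X Y Z p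
      = ((X p (\<lambda>x. Y x f) - Y p (\<lambda>x. X x f)) - (nab p (X p) Y - nab p (Y p) X) f) *\<^sub>R Z p"
    using X Y Z p by (simp add: curvature_eq * VF_scale VF_T nab_scale nab_T minus_apply algebra_simps)
  then show "curvature \<A> nab X Y (\<lambda>x. f x *\<^sub>R Z x) p = f p *\<^sub>R curvature \<A> nab X Y Z p"
    by (simp add: lie)
next
  fix Z Z' assume Z: "Z \<in> VF" "Z' \<in> VF" "\<And>x. x \<in> U \<Longrightarrow> Z x = Z' x"
  have "nab p v (cov nab W Z) = nab p v (cov nab W Z')" "nab p v Z = nab p v Z'"
    if "v \<in> T p" "W \<in> VF" for v W
    using Z p that by (auto intro!: nab_cong cov_VF cov_cong)
  then show "curvature \<A> nab X Y Z p = curvature \<A> nab X Y Z' p"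
    using X Y Z p VF_T nab_T by (simp add: curvature_eq)
qed

lemma curvature_pointwise:
  assumes E: "full_frame \<A> g U I E" and "X \<in> VF" "Y \<in> VF" "Z \<in> VF" "X' \<in> VF" "Y' \<in> VF" "Z' \<in> VF"
    and "X p = X' p" "Y p = Y' p" "Z p = Z' p"
  shows "curvature \<A> nab X Y Z p = curvature \<A> nab X' Y' Z' p"
proof -
  have "curvature \<A> nab X Y Z p = curvature \<A> nab X' Y Z p"
    by (rule tensorial_pointwise[OF curvature_tensorial1 E]) (use assms in auto)
  also have "\<dots> = curvature \<A> nab X' Y' Z p"
    by (rule tensorial_pointwise[OF curvature_tensorial2 E]) (use assms in auto)
  also have "\<dots> = curvature \<A> nab X' Y' Z' p"
    by (rule tensorial_pointwise[OF curvature_tensorial3 E]) (use assms in auto)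
  finally show ?thesis .
qed

text \<open>The commutator of two derivatives of the function \<open>g(Z, W)\<close> is its
  derivative along the bracket. The identity serves to trade \<open>g(R(e,A)B, e)\<close> for
  \<open>- g(R(e,A)e, B)\<close>, where the covariant derivatives act first on the normal field
  \<open>e\<close> and can be split.\<close>

lemma curvature_skew:
  assumes X: "X \<in> VF" and Y: "Y \<in> VF" and Z: "Z \<in> VF" and W: "W \<in> VF"
  shows "g p (curvature \<A> nab X Y Z p) (W p) = - g p (curvature \<A> nab X Y W p) (Z p)"
proof -
  \<comment> \<open>The two cross terms are symmetric in \<open>X\<close> and \<open>Y\<close> as a
    sum, hence vanish in the commutator.\<close>
  have second: "X p (\<lambda>x. Y x (\<lambda>x. g x (Z x) (W x))) =
      g p (cov nab X (cov nab Y Z) p) (W p) + g p (cov nab Y Z p) (cov nab X W p)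
      + g p (cov nab X Z p) (cov nab Y W p) + g p (Z p) (cov nab X (cov nab Y W) p)"
    if X: "X \<in> VF" and Y: "Y \<in> VF" for X Y
  proof -
    have "X p (\<lambda>x. Y x (\<lambda>x. g x (Z x) (W x)))
        = X p (\<lambda>x. g x (cov nab Y Z x) (W x) + g x (Z x) (cov nab Y W x))"
      by (rule derivation_cong[OF VF_T[OF X p] p])
        (use X Y Z W p in \<open>simp_all add: VF_smooth g_smooth metric_compatible cov_def\<close>)
    also have "\<dots> = X p (\<lambda>x. g x (cov nab Y Z x) (W x)) + X p (\<lambda>x. g x (Z x) (cov nab Y W x))"
      by (rule derivation_add) (use X Y Z W p in \<open>simp_all add: VF_T g_smooth cov_VF\<close>)
    also have "\<dots> = g p (cov nab X (cov nab Y Z) p) (W p) + g p (cov nab Y Z p) (cov nab X W p)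
      + (g p (cov nab X Z p) (cov nab Y W p) + g p (Z p) (cov nab X (cov nab Y W) p))"
      using X Y Z W p by (simp add: metric_compatible cov_VF cov_apply[of nab X])
    finally show ?thesis by simp
  qed
  have f: "CF (\<lambda>x. g x (Z x) (W x))" using Z W g_smooth by blast
  have "lie_bracket \<A> X Y p (\<lambda>x. g x (Z x) (W x))
      = g p (cov nab (lie_bracket \<A> X Y) Z p) (W p) + g p (Z p) (cov nab (lie_bracket \<A> X Y) W p)"
    using metric_compatible[OF lie_VF[OF X Y] Z W p] by (simp add: cov_def)
  moreover have "lie_bracket \<A> X Y p (\<lambda>x. g x (Z x) (W x))
      = X p (\<lambda>x. Y x (\<lambda>x. g x (Z x) (W x))) - Y p (\<lambda>x. X x (\<lambda>x. g x (Z x) (W x)))"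
    using CF_near[OF f p] by (simp add: lie_bracket_def)
  ultimately show ?thesis
    unfolding second[OF X Y] second[OF Y X] curvature_def
    using X Y Z W p by (simp add: g_diff_left g_sym[of "Z p"] T_diff VF_T cov_VF lie_VF)
qed

lemma curvature_at_eq:
  assumes E: "full_frame \<A> g U I E" and X: "X \<in> VF" and Y: "Y \<in> VF" and Z: "Z \<in> VF"
  shows "curvature_at \<A> nab p (X p) (Y p) (Z p) = curvature \<A> nab X Y Z p"
  unfolding curvature_at_def
proof (rule the_equality)
  show "\<forall>U' X' Y' Z'. open U' \<longrightarrow> p \<in> U' \<longrightarrow> X' \<in> vfields \<A> U' \<longrightarrow> Y' \<in> vfields \<A> U' \<longrightarrow>
      Z' \<in> vfields \<A> U' \<longrightarrow> X' p = X p \<longrightarrow> Y' p = Y p \<longrightarrow> Z' p = Z p \<longrightarrow>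
      curvature \<A> nab X' Y' Z' p = curvature \<A> nab X Y Z p"
  proof (intro allI impI)
    fix U' X' Y' Z'
    assume U': "open U'" "p \<in> U'"
      and VF: "X' \<in> vfields \<A> U'" "Y' \<in> vfields \<A> U'" "Z' \<in> vfields \<A> U'"
      and eq: "X' p = X p" "Y' p = Y p" "Z' p = Z p"
    \<comment> \<open>The competing fields live on their own neighbourhood \<open>U'\<close>. Both
      triples restrict to the intersection, and so does the frame, which makes pointwise dependence
      available there.\<close>
    interpret W: riemannian_open \<A> g nab "U \<inter> U'"
      by unfold_locales (simp_all add: manifold metric connection open_U U' open_Int)
    show "curvature \<A> nab X' Y' Z' p = curvature \<A> nab X Y Z p"
      by (rule W.curvature_pointwise[OF _ full_frame_subset[OF E]])
        (use p U' VF eq X Y Z in \<open>auto intro: vfields_subset\<close>)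
  qed
qed (use X Y Z p open_U in blast)

text \<open>Tangent vectors are extended to fields with constant coefficients in the frame.\<close>

lemma ricci_eq:
  assumes E: "full_frame \<A> g U I E" and X: "X \<in> VF" and Y: "Y \<in> VF"
  shows "ricci \<A> nab p (X p) (Y p) = (\<Sum>i\<in>I. g p (curvature \<A> nab (E i) X Y p) (E i p))"
proof -
  have fin: "finite I" and VF: "\<And>i. i \<in> I \<Longrightarrow> E i \<in> VF"
    and exp: "\<And>v. v \<in> T p \<Longrightarrow> v = (\<Sum>i\<in>I. g p v (E i p) *\<^sub>R E i p)"
    using E p unfolding full_frame_def by blast+
  have R: "curvature_at \<A> nab p z (X p) (Y p) = (\<Sum>i\<in>I. g p z (E i p) *\<^sub>R curvature \<A> nab (E i) X Y p)"
    if z: "z \<in> T p" for z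
  proof -
    define Z where "Z = (\<lambda>x. \<Sum>i\<in>I. g p z (E i p) *\<^sub>R E i x)"
    have Z: "Z \<in> VF" unfolding Z_def by (intro VF_sum VF_scale smooth_fun_const VF)
    have "z = Z p" using exp[OF z] by (simp add: Z_def)
    then have "curvature_at \<A> nab p z (X p) (Y p) = curvature \<A> nab Z X Y p"
      using curvature_at_eq[OF E Z X Y] by simp
    also have "\<dots> = (\<Sum>i\<in>I. g p z (E i p) *\<^sub>R curvature \<A> nab (E i) X Y p)"
      unfolding Z_def by (rule tensorial_sum[OF curvature_tensorial1[OF X Y] fin VF smooth_fun_const])
    finally show ?thesis .
  qed
  have Ei: "curvature_at \<A> nab p (E i p) (X p) (Y p) = curvature \<A> nab (E i) X Y p" if "i \<in> I" for i
    using curvature_at_eq[OF E VF[OF that] X Y] .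
  have "ricci \<A> nab p (X p) (Y p)
      = (\<Sum>i\<in>I. g p (curvature_at \<A> nab p (E i p) (X p) (Y p)) (E i p))"
    unfolding ricci_def
  proof (rule trace_on_eq[OF subspace_tangent_space fin])
    show "curvature_at \<A> nab p v (X p) (Y p) \<in> T p" if "v \<in> T p" for v
      unfolding R[OF that] by (intro T_sum T_scale curvature_T VF X Y p)
    show "curvature_at \<A> nab p v (X p) (Y p)
        = (\<Sum>i\<in>I. g p v (E i p) *\<^sub>R curvature_at \<A> nab p (E i p) (X p) (Y p))" if "v \<in> T p" for v
      unfolding R[OF that] by (simp add: Ei)
  qed (simp_all add: VF VF_T p exp[symmetric] g_add_left g_scale_left)
  then show ?thesis by (simp add: Ei)
qed

end

section \<open>Orthonormal expansion and the Koszul formula\<close>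

lemma g_0_right: "w \<in> T p \<Longrightarrow> g p w 0 = 0"
  using g_scale_right[OF T_0, of w p 0] by simp

lemma g_sum_right:
  assumes "w \<in> T p" "\<And>i. i \<in> I \<Longrightarrow> u i \<in> T p"
  shows "g p w (\<Sum>i\<in>I. u i) = (\<Sum>i\<in>I. g p w (u i))"
  using assms(2)
  by (induction I rule: infinite_finite_induct) (simp_all add: g_0_right assms(1) g_add_right T_sum)

lemma orthonormal_frame_expand:
  assumes E: "orthonormal_frame g D U I E" and D: "D x \<subseteq> T x" and fin: "finite I" and x: "x \<in> U"
    and v: "v \<in> D x"
  shows "v = (\<Sum>i\<in>I. g x v (E i x) *\<^sub>R E i x)"
proof -
  have on: "g x (E i x) (E j x) = (if i = j then 1 else 0)" if "i \<in> I" "j \<in> I" for i j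
    using E x that by (auto simp: orthonormal_frame_def)
  have sp: "span ((\<lambda>i. E i x) ` I) = D x" using E x by (auto simp: orthonormal_frame_def)
  have ET: "E i x \<in> T x" if "i \<in> I" for i
    using sp D that span_base[of "E i x" "(\<lambda>i. E i x) ` I"] by blast
  have "v \<in> span ((\<lambda>i. E i x) ` I)" using v sp by simp
  \<comment> \<open>Membership in \<open>T x\<close> is carried through the induction because
    \<open>g\<close> is additive only on tangent vectors.\<close>
  then have "v \<in> T x \<and> v = (\<Sum>i\<in>I. g x v (E i x) *\<^sub>R E i x)"
  proof (induction rule: span_induct_alt)
    case base
    show ?case by (simp add: T_0 g_0_left ET)
  next
    case (step c u w)
    then obtain j where j: "j \<in> I" "u = E j x" by blast
    have "(\<Sum>i\<in>I. g x (c *\<^sub>R u + w) (E i x) *\<^sub>R E i x)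
        = (\<Sum>i\<in>I. (c * (if j = i then 1 else 0)) *\<^sub>R E i x + g x w (E i x) *\<^sub>R E i x)"
      using step j by (intro sum.cong refl)
        (simp add: ET g_add_left g_scale_left T_scale on scaleR_add_left)
    also have "\<dots> = (\<Sum>i\<in>I. (if j = i then c *\<^sub>R E i x else 0)) + w"
      using step by (auto simp: sum.distrib if_distrib intro!: sum.cong)
    finally show ?case using step j fin by (simp add: T_add T_scale ET)
  qed
  then show ?thesis by blast
qed

lemma koszul:
  assumes X: "X \<in> VF" and Y: "Y \<in> VF" and Z: "Z \<in> VF" and p: "p \<in> U"
  shows "2 * g p (nab p (X p) Y) (Z p) =
    X p (\<lambda>x. g x (Y x) (Z x)) + Y p (\<lambda>x. g x (X x) (Z x)) - Z p (\<lambda>x. g x (X x) (Y x))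
    + g p (lie_bracket \<A> X Y p) (Z p) - g p (lie_bracket \<A> X Z p) (Y p) - g p (lie_bracket \<A> Y Z p) (X p)"
proof -
  have "nab p (A p) B \<in> T p" if "A \<in> VF" "B \<in> VF" for A B
    using that p by (simp add: nab_T VF_T)
  then show ?thesis
    using assms by (simp add: torsion_free[symmetric] metric_compatible g_diff_left VF_T
        g_sym[of "X p"] g_sym[of "Y p"])
qed

end

section \<open>Distributions with totally geodesic complement\<close>

locale split_frame = riemannian_open +
  fixes D :: "'a distribution" and I J :: "nat set" and E H :: "nat \<Rightarrow> 'a vfield"
  assumes subspace_D: "\<And>x. subspace (D x)" and D_T: "\<And>x. D x \<subseteq> tangent_space \<A> x"
    and finI: "finite I" and finJ: "finite J"
    and E: "\<And>i. i \<in> I \<Longrightarrow> E i \<in> sections \<A> D U" "orthonormal_frame g D U I E"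
    and H: "\<And>k. k \<in> J \<Longrightarrow> H k \<in> sections \<A> (orth_compl \<A> g D) U"
      "orthonormal_frame g (orth_compl \<A> g D) U J H"
    and geodesic: "perp_totally_geodesic \<A> g nab D"
begin

abbreviation "N \<equiv> orth_compl \<A> g D"
abbreviation "SD \<equiv> sections \<A> D U"
abbreviation "SN \<equiv> sections \<A> N U"
abbreviation "P \<equiv> orth_proj g D"
abbreviation "S \<equiv> shape g nab D"
abbreviation "nn \<equiv> normal_conn \<A> g nab D"

lemma SD_VF: "X \<in> SD \<Longrightarrow> X \<in> VF" and SD_D: "X \<in> SD \<Longrightarrow> x \<in> U \<Longrightarrow> X x \<in> D x"
  by (auto simp: sections_def)

lemma SN_VF: "X \<in> SN \<Longrightarrow> X \<in> VF" and SN_N: "X \<in> SN \<Longrightarrow> x \<in> U \<Longrightarrow> X x \<in> N x"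
  by (auto simp: sections_def)

lemma D_in_T: "v \<in> D x \<Longrightarrow> v \<in> T x" using D_T by blast

lemma N_in_T: "v \<in> N x \<Longrightarrow> v \<in> T x" by (simp add: orth_compl_def)

lemma g_N_D: "v \<in> N x \<Longrightarrow> w \<in> D x \<Longrightarrow> g x v w = 0" by (simp add: orth_compl_def)

lemma g_D_N: "w \<in> D x \<Longrightarrow> v \<in> N x \<Longrightarrow> g x w v = 0"
  using g_sym[of v x w] D_in_T N_in_T g_N_D by simp

lemma N_I: "v \<in> T x \<Longrightarrow> (\<And>w. w \<in> D x \<Longrightarrow> g x v w = 0) \<Longrightarrow> v \<in> N x"
  by (simp add: orth_compl_def)

lemma subspace_N: "subspace (N x)"
  by (rule subspaceI)
    (auto simp: orth_compl_def g_0_left g_add_left g_scale_left T_add T_scale T_0 D_in_T)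

lemmas D_add = subspace_add[OF subspace_D] and D_diff = subspace_diff[OF subspace_D]
  and D_scale = subspace_scale[OF subspace_D] and D_minus = subspace_neg[OF subspace_D]
  and D_sum = subspace_sum[OF subspace_D]
  and N_sum = subspace_sum[OF subspace_N] and N_scale = subspace_scale[OF subspace_N]

lemma E_VF: "i \<in> I \<Longrightarrow> E i \<in> VF" and E_D: "i \<in> I \<Longrightarrow> x \<in> U \<Longrightarrow> E i x \<in> D x"
  using E(1) SD_VF SD_D by auto

lemma H_VF: "k \<in> J \<Longrightarrow> H k \<in> VF" and H_N: "k \<in> J \<Longrightarrow> x \<in> U \<Longrightarrow> H k x \<in> N x"
  using H(1) SN_VF SN_N by auto

lemma D_expand: "x \<in> U \<Longrightarrow> v \<in> D x \<Longrightarrow> v = (\<Sum>i\<in>I. g x v (E i x) *\<^sub>R E i x)"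
  by (rule orthonormal_frame_expand[OF E(2) D_T finI])

lemma N_expand: "x \<in> U \<Longrightarrow> v \<in> N x \<Longrightarrow> v = (\<Sum>k\<in>J. g x v (H k x) *\<^sub>R H k x)"
  by (rule orthonormal_frame_expand[OF H(2) _ finJ]) (auto simp: N_in_T)

lemma D_N_0: "v \<in> D x \<Longrightarrow> v \<in> N x \<Longrightarrow> v = 0"
  using g_pos[of v x] g_N_D[of v x v] N_in_T by force

section \<open>Orthogonal projections onto \<open>D\<close> and its complement\<close>

context
  fixes x v assumes x: "x \<in> U" and v: "v \<in> T x"
begin

text \<open>The projection is a definite description; the closed formula in the frame gives its
  existence, and later its linearity and its smoothness on fields.\<close>

lemma P_eq: "P x v = (\<Sum>i\<in>I. g x v (E i x) *\<^sub>R E i x)" (is "_ = ?u")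
  unfolding orth_proj_def
proof (rule the_equality)
  have u: "?u \<in> D x" by (intro D_sum D_scale E_D x)
  have "g x (v - ?u) w = 0" if w: "w \<in> D x" for w
  proof -
    have "g x v w = g x v (\<Sum>i\<in>I. g x w (E i x) *\<^sub>R E i x)" using D_expand[OF x w] by simp
    also have "\<dots> = g x ?u w"
      using v w x by (simp add: g_sum_right g_sum_left g_scale_right g_scale_left D_in_T E_D T_scale
          mult.commute g_sym[of w x])
    finally show ?thesis using v u w by (simp add: g_diff_left D_in_T)
  qed
  then show *: "?u \<in> D x \<and> (\<forall>w\<in>D x. g x (v - ?u) w = 0)" using u by blast
  fix u' assume u': "u' \<in> D x \<and> (\<forall>w\<in>D x. g x (v - u') w = 0)"
  have "v - ?u \<in> N x" "v - u' \<in> N x"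
    using * u' v by (simp_all add: orth_compl_def T_diff D_in_T)
  then have "(v - ?u) - (v - u') \<in> N x" by (rule subspace_diff[OF subspace_N])
  moreover have "(v - ?u) - (v - u') = u' - ?u" by simp
  ultimately have "u' - ?u \<in> N x" "u' - ?u \<in> D x" using * u' D_diff by auto
  then show "u' = ?u" using D_N_0 by fastforce
qed

lemma P_D: "P x v \<in> D x"
  unfolding P_eq by (intro D_sum D_scale E_D x)

lemma P_T: "P x v \<in> T x"
  by (rule D_in_T[OF P_D])

lemma g_P: "w \<in> D x \<Longrightarrow> g x (P x v) w = g x v w"
proof -
  assume w: "w \<in> D x"
  have "g x v w = g x v (\<Sum>i\<in>I. g x w (E i x) *\<^sub>R E i x)" using D_expand[OF x w] by simp
  then show ?thesis
    using v w x by (simp add: P_eq g_sum_right g_sum_left g_scale_right g_scale_left D_in_T E_D T_scale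
        mult.commute g_sym[of w x])
qed

lemma diff_P_N: "v - P x v \<in> N x"
  by (rule N_I) (simp_all add: v T_diff P_T g_diff_left D_in_T g_P)

lemma P_unique: "u \<in> D x \<Longrightarrow> v - u \<in> N x \<Longrightarrow> P x v = u"
  using D_N_0[of "P x v - u" x] D_diff[OF P_D, of u]
    subspace_diff[OF subspace_N _ diff_P_N, of "v - u"] by simp

lemma proj_N: "orth_proj g N x v = v - P x v"
  unfolding orth_proj_def[of g N]
proof (rule the_equality)
  show "v - P x v \<in> N x \<and> (\<forall>w\<in>N x. g x (v - (v - P x v)) w = 0)"
    using diff_P_N P_D g_D_N by simp
  fix u assume u: "u \<in> N x \<and> (\<forall>w\<in>N x. g x (v - u) w = 0)"
  have d: "u - (v - P x v) \<in> N x" using u diff_P_N by (blast intro: subspace_diff[OF subspace_N])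
  \<comment> \<open>The difference equals \<open>P x v - (v - u)\<close>, and both terms are
    orthogonal to \<open>N x\<close>, which contains the difference.\<close>
  have "g x (u - (v - P x v)) (u - (v - P x v)) = 0"
  proof -
    have "u - (v - P x v) = P x v - (v - u)" by simp
    then have "g x (u - (v - P x v)) (u - (v - P x v))
        = g x (P x v) (u - (v - P x v)) - g x (v - u) (u - (v - P x v))"
      using g_diff_left[OF P_T, of "v - u" "u - (v - P x v)"] u d v N_in_T T_diff by metis
    then show ?thesis using u d g_D_N[OF P_D d] by simp
  qed
  then show "u = v - P x v" using g_pos[OF N_in_T[OF d]] by force
qed

end

lemma P_add: "x \<in> U \<Longrightarrow> v \<in> T x \<Longrightarrow> w \<in> T x \<Longrightarrow> P x (v + w) = P x v + P x w"
  by (simp add: P_eq T_add g_add_left E_D D_in_T scaleR_add_left sum.distrib)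

lemma P_scale: "x \<in> U \<Longrightarrow> v \<in> T x \<Longrightarrow> P x (c *\<^sub>R v) = c *\<^sub>R P x v"
  by (simp add: P_eq T_scale g_scale_left E_D D_in_T scaleR_sum_right)

lemma P_minus: "x \<in> U \<Longrightarrow> v \<in> T x \<Longrightarrow> P x (- v) = - P x v"
  using P_scale[of x v "-1"] by simp

lemma P_on_N: "x \<in> U \<Longrightarrow> v \<in> N x \<Longrightarrow> P x v = 0"
  by (rule P_unique) (simp_all add: N_in_T subspace_0[OF subspace_D])

lemma full_frame: "full_frame \<A> g U (I <+> J) (case_sum E H)"
  unfolding full_frame_def
proof (intro conjI ballI)
  fix x v assume x: "x \<in> U" and v: "v \<in> T x"
  have "v - P x v = (\<Sum>k\<in>J. g x (v - P x v) (H k x) *\<^sub>R H k x)"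
    by (rule N_expand[OF x diff_P_N[OF x v]])
  also have "\<dots> = (\<Sum>k\<in>J. g x v (H k x) *\<^sub>R H k x)"
    using x v by (intro sum.cong refl) (simp add: g_diff_left P_T H_N N_in_T g_D_N[OF P_D])
  finally have eq: "v - P x v = (\<Sum>k\<in>J. g x v (H k x) *\<^sub>R H k x)" .
  have "(\<Sum>i\<in>I <+> J. g x v (case_sum E H i x) *\<^sub>R case_sum E H i x)
      = P x v + (\<Sum>k\<in>J. g x v (H k x) *\<^sub>R H k x)"
    by (simp add: P_eq[OF x v] sum.Plus finI finJ)
  also have "\<dots> = v" unfolding eq[symmetric] by simp
  finally show "v = (\<Sum>i\<in>I <+> J. g x v (case_sum E H i x) *\<^sub>R case_sum E H i x)" ..
qed (use finI finJ E_VF H_VF in auto)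

lemma P_SD: "X \<in> VF \<Longrightarrow> (\<lambda>x. P x (X x)) \<in> SD"
proof -
  assume X: "X \<in> VF"
  have "(\<lambda>x. P x (X x)) \<in> VF"
    by (rule VF_cong[OF _ VF_sum[of I "\<lambda>i x. g x (X x) (E i x) *\<^sub>R E i x"]])
      (use X in \<open>auto simp: P_eq VF_T intro!: VF_scale g_smooth E_VF\<close>)
  then show ?thesis using X by (simp add: sections_def P_D VF_T)
qed

lemma diff_P_SN: "X \<in> VF \<Longrightarrow> (\<lambda>x. X x - P x (X x)) \<in> SN"
  using VF_diff[OF _ SD_VF[OF P_SD], of X X] by (simp add: sections_def diff_P_N VF_T)

lemma shape_SD:
  assumes X: "X \<in> VF" and V: "V \<in> VF"
  shows "(\<lambda>x. S x V (X x)) \<in> SD"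
  using P_SD[OF VF_minus[OF cov_VF[OF X V]]] VF_cong[of U "\<lambda>x. P x (- cov nab X V x)" "\<lambda>x. S x V (X x)"]
  by (simp add: sections_def shape_def P_minus cov_apply nab_T VF_T X V)

lemma cov_normal_SN:
  assumes X: "X \<in> VF" and V: "V \<in> VF"
  shows "cov nn X V \<in> SN"
proof -
  have eq: "cov nab X V x - P x (cov nab X V x) = cov nn X V x" if "x \<in> U" for x
    using that by (simp add: cov_apply normal_conn_def proj_N nab_T VF_T X V)
  have "(\<lambda>x. cov nab X V x - P x (cov nab X V x)) \<in> SN"
    by (rule diff_P_SN[OF cov_VF[OF X V]])
  then show ?thesis
    using VF_cong[OF eq] by (auto simp: sections_def eq)
qed

text \<open>The totally geodesic hypothesis concerns pairs of normal fields, while directions occur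
  below as single vectors. Constant coefficients in the frame \<open>H\<close> bridge the
  two.\<close>

lemma extend_N:
  assumes x: "x \<in> U" and v: "v \<in> N x"
  shows "\<exists>V\<in>SN. V x = v"
proof (rule bexI[of _ "\<lambda>y. \<Sum>k\<in>J. g x v (H k x) *\<^sub>R H k y"])
  show "(\<lambda>y. \<Sum>k\<in>J. g x v (H k x) *\<^sub>R H k y) x = v" using N_expand[OF x v] by simp
  show "(\<lambda>y. \<Sum>k\<in>J. g x v (H k x) *\<^sub>R H k y) \<in> SN"
    unfolding sections_def
    by (auto intro!: VF_sum VF_scale smooth_fun_const H_VF N_sum N_scale H_N)
qed

lemma nab_N_N:
  assumes q: "q \<in> U" and v: "v \<in> N q" and W: "W \<in> SN"
  shows "nab q v W \<in> N q"
proof -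
  obtain V where V: "V \<in> SN" "V q = v" using extend_N[OF q v] by blast
  have "cov nab V W q = cov nn V W q"
    using geodesic open_U V W q unfolding perp_totally_geodesic_def by blast
  moreover have "cov nn V W q \<in> N q" using cov_normal_SN V W SN_VF SN_N q by blast
  ultimately show ?thesis using V by (simp add: cov_apply)
qed

text \<open>Derivatives of normal fields in normal directions stay normal. This removes one of the
  two shape terms whenever the curvature has one normal direction.\<close>

lemma shape_normal_0: "V \<in> SN \<Longrightarrow> W \<in> SN \<Longrightarrow> x \<in> U \<Longrightarrow> S x W (V x) = 0"
  by (simp add: shape_def P_on_N nab_N_N SN_N)

section \<open>Shape operators and normal derivatives at a point\<close>

context
  fixes q assumes q: "q \<in> U"
begin

text \<open>Differentiating \<open>g(A, W) = 0\<close> in a normal direction gives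
  \<open>g(nab A, W) = - g(A, nab W)\<close>, and the right side vanishes because the derivative of
  the normal field \<open>W\<close> is normal.\<close>

lemma nab_N_D: "v \<in> N q \<Longrightarrow> A \<in> SD \<Longrightarrow> nab q v A \<in> D q"
proof -
  assume v: "v \<in> N q" and A: "A \<in> SD"
  obtain V where V: "V \<in> SN" "V q = v" using extend_N[OF q v] by blast
  let ?w = "nab q v A"
  have wT: "?w \<in> T q" by (rule nab_T[OF q N_in_T[OF v] SD_VF[OF A]])
  have orth: "g q ?w w = 0" if w: "w \<in> N q" for w
  proof -
    obtain W where W: "W \<in> SN" "W q = w" using extend_N[OF q w] by blast
    have "V q (\<lambda>x. g x (A x) (W x)) = V q (\<lambda>x. 0)"
      by (rule derivation_cong[OF _ q]) (use V W A q in
          \<open>auto simp: VF_T SN_VF SD_VF g_D_N SD_D SN_N intro!: g_smooth\<close>)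
    also have "\<dots> = 0" using tangent_const[OF VF_T[OF SN_VF[OF V(1)] q]] .
    finally have "g q (nab q v A) w + g q (A q) (nab q v W) = 0"
      using metric_compatible[OF SN_VF[OF V(1)] SD_VF[OF A] SN_VF[OF W(1)] q] V W by simp
    then show ?thesis using g_D_N[OF SD_D[OF A q] nab_N_N[OF q v W(1)]] by simp
  qed
  \<comment> \<open>Orthogonality to \<open>N q\<close> is turned into membership in
    \<open>D q\<close> by showing that the normal part of \<open>?w\<close> is orthogonal to
    itself.\<close>
  have d: "?w - P q ?w \<in> N q" by (rule diff_P_N[OF q wT])
  have "g q (?w - P q ?w) (?w - P q ?w) = 0"
    using orth[OF d] g_D_N[OF P_D[OF q wT] d] by (simp add: g_diff_left wT P_T q T_diff)
  then have "?w - P q ?w = 0" using g_pos[OF N_in_T[OF d]] by force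
  then show ?thesis using P_D[OF q wT] by simp
qed

lemma g_shape: "w \<in> T q \<Longrightarrow> V \<in> VF \<Longrightarrow> b \<in> D q \<Longrightarrow> g q (S q V w) b = - g q (nab q w V) b"
  by (simp add: shape_def g_minus_left P_T nab_T q D_in_T g_P)

lemma shape_D: "w \<in> T q \<Longrightarrow> V \<in> VF \<Longrightarrow> S q V w \<in> D q"
  by (simp add: shape_def D_minus P_D nab_T q)

lemma normal_N: "w \<in> T q \<Longrightarrow> V \<in> VF \<Longrightarrow> nn q w V \<in> N q"
  by (simp add: normal_conn_def proj_N diff_P_N nab_T q)

lemma nab_split: "w \<in> T q \<Longrightarrow> V \<in> VF \<Longrightarrow> nab q w V = nn q w V - S q V w"
  by (simp add: normal_conn_def shape_def proj_N nab_T q)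

lemma nab_cov_split:
  assumes "w \<in> T q" "X \<in> VF" "V \<in> VF"
  shows "nab q w (cov nab X V) = nab q w (cov nn X V) - nab q w (\<lambda>x. S x V (X x))"
proof -
  have n: "cov nn X V \<in> VF" using cov_normal_SN SN_VF assms by blast
  have s: "(\<lambda>x. S x V (X x)) \<in> VF" using shape_SD SD_VF assms by blast
  have "nab q w (cov nab X V) = nab q w (\<lambda>x. cov nn X V x - S x V (X x))"
    by (rule nab_cong[OF q assms(1) VF_diff[OF n s] cov_VF])
      (use assms in \<open>simp_all add: cov_apply VF_T normal_conn_def shape_def proj_N nab_T\<close>)
  then show ?thesis using nab_diff[OF q assms(1) n s] by simp
qed

text \<open>Common start of the four mixed computations. The inner derivatives of \<open>V\<close>
  are split, while the outer ones and those in the directions \<open>nab q (X q) Y\<close> and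
  \<open>nab q (Y q) X\<close> stay whole, since their treatment depends on whether \<open>b\<close>
  is tangent to \<open>D\<close> or normal.\<close>

lemma g_curvature_split:
  assumes X: "X \<in> VF" and Y: "Y \<in> VF" and V: "V \<in> VF" and b: "b \<in> T q"
  shows "g q (curvature \<A> nab X Y V q) b =
      g q (nab q (X q) (cov nn Y V)) b - g q (nab q (X q) (\<lambda>x. S x V (Y x))) b
    - g q (nab q (Y q) (cov nn X V)) b + g q (nab q (Y q) (\<lambda>x. S x V (X x))) b
    - g q (nab q (nab q (X q) Y) V) b + g q (nab q (nab q (Y q) X) V) b"
proof -
  have n: "cov nn X V \<in> VF" "cov nn Y V \<in> VF" using cov_normal_SN SN_VF assms by blast+
  have s: "(\<lambda>x. S x V (X x)) \<in> VF" "(\<lambda>x. S x V (Y x)) \<in> VF" using shape_SD SD_VF assms by blast+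
  have 1: "nab q (X q) Y \<in> T q" "nab q (Y q) X \<in> T q" using q X Y by (simp_all add: nab_T VF_T)
  have "curvature \<A> nab X Y V q = nab q (X q) (cov nn Y V) - nab q (X q) (\<lambda>x. S x V (Y x))
    - (nab q (Y q) (cov nn X V) - nab q (Y q) (\<lambda>x. S x V (X x)))
    - nab q (nab q (X q) Y) V + nab q (nab q (Y q) X) V"
    using X Y V q by (simp add: curvature_eq nab_cov_split VF_T)
  moreover have "nab q w Z \<in> T q" if "w \<in> T q" "Z \<in> VF" for w Z
    using q that by (simp add: nab_T)
  ultimately show ?thesis
    using n s 1 X Y V b q by (simp add: g_diff_left g_add_left T_diff VF_T)
qed

lemma nab_zero:
  assumes "w \<in> T q" "Z \<in> VF" "\<And>x. x \<in> U \<Longrightarrow> Z x = 0"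
  shows "nab q w Z = 0"
proof -
  have "nab q w Z = nab q w (\<lambda>x. 0 *\<^sub>R Z x)"
    by (rule nab_cong[OF q assms(1) VF_scale[OF smooth_fun_const assms(2)] assms(2)])
      (simp add: assms(3))
  then show ?thesis
    using nab_scale[OF q assms(1,2) smooth_fun_const, of 0] tangent_const[OF assms(1)] by simp
qed

lemma shape_add: "a \<in> T q \<Longrightarrow> b \<in> T q \<Longrightarrow> V \<in> VF \<Longrightarrow> S q V (a + b) = S q V a + S q V b"
  by (simp add: shape_def nab_add_dir nab_T P_add q)

lemma shape_scale: "a \<in> T q \<Longrightarrow> V \<in> VF \<Longrightarrow> S q V (c *\<^sub>R a) = c *\<^sub>R S q V a"
  by (simp add: shape_def nab_scale_dir nab_T P_scale q)

lemma D_induct [consumes 1]: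
  assumes v: "v \<in> D q" and "Q 0" "\<And>u w. u \<in> D q \<Longrightarrow> w \<in> D q \<Longrightarrow> Q u \<Longrightarrow> Q w \<Longrightarrow> Q (u + w)"
    and "\<And>c u. u \<in> D q \<Longrightarrow> Q u \<Longrightarrow> Q (c *\<^sub>R u)" "\<And>i. i \<in> I \<Longrightarrow> Q (E i q)"
  shows "Q v"
proof -
  have "(\<Sum>i\<in>K. g q v (E i q) *\<^sub>R E i q) \<in> D q \<and> Q (\<Sum>i\<in>K. g q v (E i q) *\<^sub>R E i q)"
    if "K \<subseteq> I" for K
    using finite_subset[OF that finI] that
  proof (induction K)
    case empty
    show ?case using assms(2) subspace_0[OF subspace_D] by simp
  next
    case (insert i K)
    then have i: "i \<in> I" by blast
    have "g q v (E i q) *\<^sub>R E i q \<in> D q \<and> Q (g q v (E i q) *\<^sub>R E i q)"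
      using D_scale[OF E_D[OF i q]] assms(4)[OF E_D[OF i q] assms(5)[OF i]] by blast
    moreover have "(\<Sum>i\<in>K. g q v (E i q) *\<^sub>R E i q) \<in> D q \<and> Q (\<Sum>i\<in>K. g q v (E i q) *\<^sub>R E i q)"
      using insert by blast
    ultimately show ?case
      unfolding sum.insert[OF insert(1,2)] using assms(3) D_add by blast
  qed
  from this[of I] show ?thesis using D_expand[OF q v] by simp
qed

lemma g_nab_N_D:
  assumes "v \<in> N q" "W \<in> SN" "b \<in> D q"
  shows "g q (nab q v W) b = 0"
  by (rule g_N_D[OF nab_N_N[OF q assms(1,2)] assms(3)])

lemma g_shape_D: "w \<in> T q \<Longrightarrow> V \<in> VF \<Longrightarrow> b \<in> D q \<Longrightarrow> g q (nab q w V) b = - g q (S q V w) b"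
  by (simp add: g_shape)

lemma g_normal_N: "w \<in> T q \<Longrightarrow> V \<in> VF \<Longrightarrow> b \<in> N q \<Longrightarrow> g q (nab q w V) b = g q (nn q w V) b"
  by (simp add: normal_conn_def proj_N nab_T q g_diff_left P_T N_in_T g_D_N[OF P_D])

text \<open>Self-adjointness is a property of the point \<open>q\<close>: it is the infinitesimal
  form of involutivity of \<open>D\<close>, which is available only on the image of
  \<open>F\<close>.\<close>

definition shape_sym :: bool where
  "shape_sym \<longleftrightarrow> (\<forall>V\<in>SN. \<forall>a\<in>D q. \<forall>b\<in>D q. g q (S q V a) b = g q a (S q V b))"

text \<open>Up to sign, \<open>g (S\<^sub>V A) B\<close> is the \<open>V\<close>-component of the covariant derivative of \<open>B\<close> along \<open>A\<close>, so
  its skew part is the \<open>V\<close>-component of the bracket.\<close>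

lemma shape_symI:
  assumes lie: "\<And>i j. i \<in> I \<Longrightarrow> j \<in> I \<Longrightarrow> lie_bracket \<A> (E i) (E j) q \<in> D q"
  shows "shape_sym"
  unfolding shape_sym_def
proof (intro ballI)
  fix V a b assume V: "V \<in> SN" and a: "a \<in> D q" and b: "b \<in> D q"
  note VF = SN_VF[OF V]
  have base: "g q (S q V (E i q)) (E j q) = g q (V q) (nab q (E i q) (E j))"
    if i: "i \<in> I" and j: "j \<in> I" for i j
  proof -
    have "E i q (\<lambda>x. g x (V x) (E j x)) = E i q (\<lambda>_. 0)"
      by (rule derivation_cong[OF VF_T[OF E_VF[OF i] q] q])
        (use V j in \<open>auto intro!: g_smooth SN_VF E_VF g_N_D SN_N E_D\<close>)
    then have "g q (nab q (E i q) V) (E j q) + g q (V q) (nab q (E i q) (E j)) = 0"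
      using metric_compatible[OF E_VF[OF i] VF E_VF[OF j] q] tangent_const[OF VF_T[OF E_VF[OF i] q]]
      by simp
    then show ?thesis using i j q by (simp add: g_shape VF E_VF VF_T E_D)
  qed
  have sym: "g q (S q V (E i q)) (E j q) = g q (E i q) (S q V (E j q))" if i: "i \<in> I" and j: "j \<in> I" for i j
  proof -
    have "g q (V q) (nab q (E i q) (E j) - nab q (E j q) (E i)) = 0"
      using g_N_D[OF SN_N[OF V q] lie[OF i j]] torsion_free[OF E_VF[OF i] E_VF[OF j] q] by simp
    then have "g q (S q V (E i q)) (E j q) = g q (S q V (E j q)) (E i q)"
      using i j q by (simp add: base g_diff_right nab_T VF_T VF E_VF)
    then show ?thesis
      using i j q by (simp add: g_sym[of "E i q"] shape_D D_in_T VF VF_T E_VF)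
  qed
  have sym': "g q (S q V a) (E j q) = g q a (S q V (E j q))" if j: "j \<in> I" for j
    using a
  proof (induction a rule: D_induct)
    case 1
    show ?case
      using shape_scale[OF T_0 VF, of 0] j q by (simp add: g_0_left shape_D D_in_T VF VF_T E_VF)
  qed (use j q in \<open>simp_all add: shape_add shape_scale g_add_left g_scale_left D_in_T shape_D VF
      VF_T E_VF sym E_D\<close>)
  show "g q (S q V a) b = g q a (S q V b)"
    using b
  proof (induction b rule: D_induct)
    case 1
    show ?case
      using shape_scale[OF T_0 VF, of 0] a by (simp add: g_0_right shape_D D_in_T VF)
  qed (use a q in \<open>simp_all add: shape_add shape_scale g_add_right g_scale_right D_in_T shape_D VF
      VF_T E_VF sym' E_D\<close>)
qed

section \<open>Mixed components of the curvature\<close>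

lemma shape_symD: "shape_sym \<Longrightarrow> V \<in> SN \<Longrightarrow> a \<in> D q \<Longrightarrow> b \<in> D q \<Longrightarrow> g q (S q V a) b = g q a (S q V b)"
  unfolding shape_sym_def by blast

text \<open>By skew symmetry it is enough to find the component of \<open>R(e,A)e\<close> along
  \<open>B\<close>. There the derivative of \<open>cov nn A e\<close> in the normal direction
  \<open>e q\<close> has no tangential part, the field \<open>S x e (e x)\<close> vanishes on
  \<open>U\<close>, and the four remaining terms are those of the formula.\<close>

lemma curvature_mixed_tangent:
  assumes e: "e \<in> SN" and A: "A \<in> SD" and B: "B \<in> SD" and sym: shape_sym
  shows "g q (curvature \<A> nab e A B q) (e q) =
    - (g q (S q (cov nn e e) (A q)) (B q) - g q (nab q (e q) (\<lambda>x. S x e (A x))) (B q)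
       + g q (S q e (A q)) (S q e (B q)) + g q (nab q (e q) A) (S q e (B q)))"
proof -
  note VF = SN_VF[OF e] SD_VF[OF A] SD_VF[OF B]
  have eN: "e q \<in> N q" and AD: "A q \<in> D q" and BD: "B q \<in> D q" using e A B SN_N SD_D q by auto
  note inT = N_in_T[OF eN] D_in_T[OF AD] D_in_T[OF BD]
  have ns: "cov nn A e \<in> SN" "cov nn e e \<in> SN" and s: "(\<lambda>x. S x e (e x)) \<in> SD"
    using cov_normal_SN shape_SD VF by auto
  have z: "nab q (A q) (\<lambda>x. S x e (e x)) = 0"
    by (rule nab_zero[OF inT(2) SD_VF[OF s]]) (rule shape_normal_0[OF e e])
  have S_D: "S q e (A q) \<in> D q" and n_N: "nn q (A q) e \<in> N q" and n_D: "nab q (e q) A \<in> D q"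
    using shape_D normal_N nab_N_D inT VF eN A by auto
  \<comment> \<open>Source of the quadratic term: the direction \<open>nab q (A q) e\<close> has a
    normal part, which contributes nothing along \<open>B\<close>, and the part
    \<open>- S q e (A q)\<close>, from which symmetry of the shape operator produces the product of
    two shape values.\<close>
  have "nab q (nab q (A q) e) e = nab q (nn q (A q) e) e - nab q (S q e (A q)) e"
    using nab_split[OF inT(2) VF(1)] nab_diff_dir[OF q N_in_T[OF n_N] D_in_T[OF S_D] VF(1)] by simp
  then have "g q (nab q (nab q (A q) e) e) (B q) = g q (S q e (A q)) (S q e (B q))"
    using g_nab_N_D[OF n_N e BD] shape_symD[OF sym e S_D BD]
    by (simp add: g_diff_left nab_T q N_in_T[OF n_N] D_in_T[OF S_D] VF inT g_shape_D BD)
  moreover have "g q (nab q (nab q (e q) A) e) (B q) = - g q (nab q (e q) A) (S q e (B q))"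
    using g_shape_D[OF D_in_T[OF n_D] VF(1) BD] shape_symD[OF sym e n_D BD] by simp
  ultimately have "g q (curvature \<A> nab e A e q) (B q) =
      - g q (nab q (e q) (\<lambda>x. S x e (A x))) (B q) + g q (S q (cov nn e e) (A q)) (B q)
      + g q (nab q (e q) A) (S q e (B q)) + g q (S q e (A q)) (S q e (B q))"
    using g_curvature_split[OF VF(1,2,1) inT(3)] g_nab_N_D[OF eN ns(1) BD]
      g_shape_D[OF inT(2) SN_VF[OF ns(2)] BD] z g_0_left[OF inT(3)] by simp
  then show ?thesis using curvature_skew[OF q VF(1,2,3) VF(1)] by simp
qed

text \<open>The factor 2 has two sources. One copy is the correction in the product rule for
  \<open>V(g(S\<^sub>W A, A))\<close>; the other comes from differentiating \<open>W\<close> in the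
  direction \<open>nab q (V q) A\<close>, which is tangent to \<open>D\<close>, so that symmetry of
  the shape operator applies.\<close>

lemma curvature_mixed_normal:
  assumes A: "A \<in> SD" and V: "V \<in> SN" and W: "W \<in> SN" and sym: shape_sym
  shows "g q (curvature \<A> nab A V W q) (A q) =
    - (g q (S q (cov nn V W) (A q)) (A q) + g q (S q V (A q)) (S q W (A q))
       - V q (\<lambda>x. g x (S x W (A x)) (A x)) + 2 * g q (S q W (A q)) (nab q (V q) A))"
proof -
  note VF = SD_VF[OF A] SN_VF[OF V] SN_VF[OF W]
  have AD: "A q \<in> D q" and VN: "V q \<in> N q" using A V SN_N SD_D q by auto
  note inT = D_in_T[OF AD] N_in_T[OF VN]
  have ns: "cov nn A W \<in> SN" "cov nn V W \<in> SN"
    and s: "(\<lambda>x. S x W (V x)) \<in> SD" "(\<lambda>x. S x W (A x)) \<in> SD"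
    using cov_normal_SN shape_SD VF by auto
  have z: "nab q (A q) (\<lambda>x. S x W (V x)) = 0"
    by (rule nab_zero[OF inT(1) SD_VF[OF s(1)]]) (rule shape_normal_0[OF V W])
  have S_D: "S q V (A q) \<in> D q" "S q W (A q) \<in> D q" and n_N: "nn q (A q) V \<in> N q"
    and n_D: "nab q (V q) A \<in> D q"
    using shape_D normal_N nab_N_D inT VF VN A by auto
  have "nab q (nab q (A q) V) W = nab q (nn q (A q) V) W - nab q (S q V (A q)) W"
    using nab_split[OF inT(1) VF(2)] nab_diff_dir[OF q N_in_T[OF n_N] D_in_T[OF S_D(1)] VF(3)] by simp
  then have "g q (nab q (nab q (A q) V) W) (A q) = g q (S q V (A q)) (S q W (A q))"
    using g_nab_N_D[OF n_N W AD] shape_symD[OF sym W S_D(1) AD]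
    by (simp add: g_diff_left nab_T q N_in_T[OF n_N] D_in_T[OF S_D(1)] VF inT g_shape_D AD)
  moreover have "g q (nab q (nab q (V q) A) W) (A q) = - g q (S q W (A q)) (nab q (V q) A)"
    using g_shape_D[OF D_in_T[OF n_D] VF(3) AD] shape_symD[OF sym W n_D AD]
      g_sym[OF D_in_T[OF n_D] D_in_T[OF S_D(2)]] by simp
  moreover have "V q (\<lambda>x. g x (S x W (A x)) (A x)) =
      g q (nab q (V q) (\<lambda>x. S x W (A x))) (A q) + g q (S q W (A q)) (nab q (V q) A)"
    by (rule metric_compatible[OF VF(2) SD_VF[OF s(2)] VF(1) q])
  ultimately show ?thesis
    using g_curvature_split[OF VF inT(1)] g_nab_N_D[OF VN ns(1) AD]
      g_shape_D[OF inT(1) SN_VF[OF ns(2)] AD] z g_0_left[OF inT(1)] by simp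
qed

text \<open>The terms are grouped by the field along which one differentiates; each group is the
  expression that \<open>shape_deriv_eq\<close> finds for a covariant derivative of the shape
  operator.\<close>

lemma codazzi:
  assumes A: "A \<in> SD" and B: "B \<in> SD" and V: "V \<in> SN" and c: "c \<in> D q"
  shows "g q (curvature \<A> nab B A V q) c =
      g q (P q (nab q (A q) (\<lambda>x. S x V (B x))) - S q (cov nn A V) (B q) - S q V (P q (nab q (A q) B))) c
    - g q (P q (nab q (B q) (\<lambda>x. S x V (A x))) - S q (cov nn B V) (A q) - S q V (P q (nab q (B q) A))) c"
proof -
  note VF = SD_VF[OF A] SD_VF[OF B] SN_VF[OF V]
  have T: "A q \<in> T q" "B q \<in> T q" "c \<in> T q" using A B c SD_D D_in_T q by auto
  have VF': "cov nn A V \<in> VF" "cov nn B V \<in> VF" "(\<lambda>x. S x V (A x)) \<in> VF" "(\<lambda>x. S x V (B x)) \<in> VF"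
    using cov_normal_SN shape_SD VF SN_VF SD_VF by blast+
  \<comment> \<open>Used for the derivatives of \<open>A\<close> and \<open>B\<close> along each
    other. Their normal parts contribute nothing along \<open>c\<close>, which is why the projection
    \<open>P\<close> stands inside the last shape terms.\<close>
  have key: "g q (nab q w V) c = - g q (S q V (P q w)) c" if w: "w \<in> T q" for w
  proof -
    have d: "w - P q w \<in> N q" by (rule diff_P_N[OF q w])
    have "nab q (P q w + (w - P q w)) V = nab q (P q w) V + nab q (w - P q w) V"
      by (rule nab_add_dir[OF q P_T[OF q w] VF(3) N_in_T[OF d]])
    then have "nab q w V = nab q (P q w) V + nab q (w - P q w) V" by simp
    then show ?thesis
      using g_nab_N_D[OF d V c] g_shape_D[OF P_T[OF q w] VF(3) c]
      by (simp add: g_add_left nab_T q P_T w VF N_in_T[OF d] T)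
  qed
  have nT: "nab q (B q) A \<in> T q" "nab q (A q) B \<in> T q" "nab q (A q) (\<lambda>x. S x V (B x)) \<in> T q"
    "nab q (B q) (\<lambda>x. S x V (A x)) \<in> T q"
    using T VF VF' q by (simp_all add: nab_T)
  have sT: "S q (cov nn A V) (B q) \<in> T q" "S q (cov nn B V) (A q) \<in> T q"
    "S q V (P q (nab q (A q) B)) \<in> T q" "S q V (P q (nab q (B q) A)) \<in> T q"
    using T VF VF' nT q by (simp_all add: D_in_T shape_D P_T)
  show ?thesis
    unfolding g_curvature_split[OF VF(2,1,3) T(3)] key[OF nT(1)] key[OF nT(2)]
      g_shape_D[OF T(2) VF'(1) c] g_shape_D[OF T(1) VF'(2) c]
    using T nT sT c q by (simp add: g_diff_left T_diff g_P P_T)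
qed

text \<open>Against a normal vector the roles are reversed: the derivative of
  \<open>S x V (A x)\<close> in the normal direction \<open>e q\<close> lies in \<open>D\<close> and
  drops out, while every derivative of a normal field becomes a normal derivative. The plus sign
  before the term with \<open>S q e (A q)\<close> comes from splitting
  \<open>nab q (A q) e\<close>.\<close>

lemma curvature_normal:
  assumes e: "e \<in> SN" and A: "A \<in> SD" and V: "V \<in> SN" and b: "b \<in> N q"
  shows "g q (curvature \<A> nab e A V q) b =
    - g q (nn q (A q) (cov nn e V) - cov nn e (cov nn A V) q - nn q (nn q (A q) e) V
        + nn q (S q e (A q)) V + nn q (nab q (e q) A) V) b"
proof -
  note VF = SN_VF[OF e] SD_VF[OF A] SN_VF[OF V]
  have eN: "e q \<in> N q" and AD: "A q \<in> D q" using e A SN_N SD_D q by auto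
  note inT = N_in_T[OF eN] D_in_T[OF AD] N_in_T[OF b]
  have VF': "cov nn A V \<in> VF" "cov nn e V \<in> VF" and s: "(\<lambda>x. S x V (e x)) \<in> SD" "(\<lambda>x. S x V (A x)) \<in> SD"
    using cov_normal_SN shape_SD VF SN_VF by auto
  have z: "nab q (A q) (\<lambda>x. S x V (e x)) = 0"
    by (rule nab_zero[OF inT(2) SD_VF[OF s(1)]]) (rule shape_normal_0[OF e V])
  have T: "S q e (A q) \<in> T q" "nn q (A q) e \<in> T q" "nab q (e q) A \<in> T q"
    using shape_D normal_N inT VF D_in_T N_in_T nab_T q by auto
  have "nab q (nab q (A q) e) V = nab q (nn q (A q) e) V - nab q (S q e (A q)) V"
    using nab_split[OF inT(2) VF(1)] nab_diff_dir[OF q T(2,1) VF(3)] by simp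
  then have "g q (nab q (nab q (A q) e) V) b = g q (nn q (nn q (A q) e) V) b - g q (nn q (S q e (A q)) V) b"
    by (simp add: g_diff_left nab_T q T VF inT g_normal_N b)
  moreover have "nn q w Z \<in> T q" if "w \<in> T q" "Z \<in> VF" for w Z
    using N_in_T[OF normal_N[OF that]] .
  ultimately show ?thesis
    using g_curvature_split[OF VF inT(3)] g_D_N[OF nab_N_D[OF eN s(2)] b] z g_0_left[OF inT(3)] inT T VF VF' b
    by (simp add: g_diff_left g_add_left T_diff T_add g_normal_N cov_apply)
qed

lemma ricci_split:
  assumes "X \<in> VF" "Y \<in> VF"
  shows "ricci \<A> nab q (X q) (Y q) =
    (\<Sum>i\<in>I. g q (curvature \<A> nab (E i) X Y q) (E i q)) + (\<Sum>k\<in>J. g q (curvature \<A> nab (H k) X Y q) (H k q))"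
  using ricci_eq[OF q full_frame assms] by (simp add: sum.Plus finI finJ)

end

end

section \<open>Riemannian maps\<close>

lemma pushforward_add: "pushforward \<B> F x (u + v) = pushforward \<B> F x u + pushforward \<B> F x v"
  by (auto simp: pushforward_def fun_eq_iff plus_fun_apply)

lemma pushforward_scale: "pushforward \<B> F x (c *\<^sub>R u) = c *\<^sub>R pushforward \<B> F x u"
  by (auto simp: pushforward_def fun_eq_iff scaleR_fun_def)

lemma pushforward_0: "pushforward \<B> F x 0 = 0"
  using pushforward_scale[of \<B> F x 0 0] by simp

lemma pushforward_diff: "pushforward \<B> F x (u - v) = pushforward \<B> F x u - pushforward \<B> F x v"
  using pushforward_add[of \<B> F x u "- v"] pushforward_scale[of \<B> F x "-1" v] by simp

lemma pushforward_sum: "pushforward \<B> F x (\<Sum>i\<in>I. u i) = (\<Sum>i\<in>I. pushforward \<B> F x (u i))"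
  by (induction I rule: infinite_finite_induct) (simp_all add: pushforward_0 pushforward_add)

locale framed_riemannian_map =
  M: riemannian_open \<A>\<^sub>M gM nabM \<Omega> + N: split_frame \<A>\<^sub>N gN nabN U D I J As e
  for \<A>\<^sub>M :: "('m::{t2_space,second_countable_topology}, 'e::euclidean_space) atlas"
    and gM nabM \<Omega>
    and \<A>\<^sub>N :: "('n::{t2_space,second_countable_topology}, 'd::euclidean_space) atlas"
    and gN nabN U D I J As e +
  fixes F :: "'m \<Rightarrow> 'n" and Xs :: "nat \<Rightarrow> 'm vfield"
  assumes riemannian: "riemannian_map \<A>\<^sub>M gM \<A>\<^sub>N gN F"
    and D_range: "\<And>x. D (F x) = range_at \<A>\<^sub>M \<A>\<^sub>N F x"
    and F_U: "F ` \<Omega> \<subseteq> U"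
    and Xs: "\<And>j. j \<in> I \<Longrightarrow> Xs j \<in> sections \<A>\<^sub>M (horizontal \<A>\<^sub>M \<A>\<^sub>N gM F) \<Omega>"
      "\<And>j. j \<in> I \<Longrightarrow> F_related \<A>\<^sub>N F \<Omega> (Xs j) (As j)"
begin

abbreviation "push \<equiv> pushforward \<A>\<^sub>N F"
abbreviation "Hor \<equiv> horizontal \<A>\<^sub>M \<A>\<^sub>N gM F"
abbreviation "SH \<equiv> sections \<A>\<^sub>M Hor \<Omega>"
abbreviation "related \<equiv> F_related \<A>\<^sub>N F \<Omega>"

lemma smooth_F: "smooth_map \<A>\<^sub>M \<A>\<^sub>N F"
  using riemannian by (simp add: riemannian_map_def)

lemma F_in_U: "x \<in> \<Omega> \<Longrightarrow> F x \<in> U" using F_U by blast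

lemma push_D: "u \<in> M.T x \<Longrightarrow> push x u \<in> D (F x)"
  by (simp add: D_range range_at_def)

lemma push_Hor: "w \<in> D (F x) \<Longrightarrow> \<exists>u\<in>Hor x. push x u = w"
proof -
  assume w: "w \<in> D (F x)"
  have "bij_betw (push x) (Hor x) (D (F x))"
    using riemannian unfolding riemannian_map_def D_range by blast
  then have "w \<in> push x ` Hor x" using w by (simp add: bij_betw_imp_surj_on)
  then show ?thesis by blast
qed

lemma isometry: "u \<in> Hor x \<Longrightarrow> v \<in> Hor x \<Longrightarrow> gN (F x) (push x u) (push x v) = gM x u v"
  using riemannian unfolding riemannian_map_def by blast

lemma Hor_T: "u \<in> Hor x \<Longrightarrow> u \<in> M.T x"
  by (simp add: horizontal_def orth_compl_def)

lemma Hor_ker: "u \<in> Hor x \<Longrightarrow> v \<in> M.T x \<Longrightarrow> push x v = 0 \<Longrightarrow> gM x u v = 0"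
  by (simp add: horizontal_def orth_compl_def ker_dist_def)

lemma SH_VF: "X \<in> SH \<Longrightarrow> X \<in> M.VF" and SH_Hor: "X \<in> SH \<Longrightarrow> x \<in> \<Omega> \<Longrightarrow> X x \<in> Hor x"
  by (auto simp: sections_def)

lemma relatedD: "related X A \<Longrightarrow> x \<in> \<Omega> \<Longrightarrow> A (F x) = push x (X x)"
  by (simp add: F_related_def)

text \<open>Brackets and covariant derivatives of horizontal fields need not be horizontal, so one
  argument is left general. It differs from a horizontal vector with the same image by an element of
  the kernel, to which \<open>z\<close> is orthogonal.\<close>

lemma g_push:
  assumes u: "u \<in> M.T x" and z: "z \<in> Hor x"
  shows "gN (F x) (push x u) (push x z) = gM x u z"
proof -
  obtain h where h: "h \<in> Hor x" "push x h = push x u" using push_Hor[OF push_D[OF u]] by blast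
  have "gM x z (u - h) = 0"
    by (rule Hor_ker[OF z]) (simp_all add: M.T_diff u Hor_T h pushforward_diff)
  then have "gM x u z = gM x h z"
    using u h z by (simp add: M.g_diff_right M.g_sym[of z] Hor_T)
  then show ?thesis using isometry[OF h(1) z] h by simp
qed

section \<open>Brackets and connections of related fields\<close>

lemma related_derivative:
  assumes A: "A \<in> N.VF" and rel: "related X A" and f: "smooth_near \<A>\<^sub>N (F p) f" and p: "p \<in> \<Omega>"
  shows "A (F p) f = X p (f \<circ> F)"
  using f relatedD[OF rel p] by (simp add: pushforward_def)

lemma lie_bracket_related:
  assumes X: "X \<in> M.VF" "A \<in> N.VF" "related X A" and Y: "Y \<in> M.VF" "B \<in> N.VF" "related Y B"
    and p: "p \<in> \<Omega>"
  shows "lie_bracket \<A>\<^sub>N A B (F p) = push p (lie_bracket \<A>\<^sub>M X Y p)"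
proof
  fix f
  show "lie_bracket \<A>\<^sub>N A B (F p) f = push p (lie_bracket \<A>\<^sub>M X Y p) f"
  proof (cases "smooth_near \<A>\<^sub>N (F p) f")
    case False
    then show ?thesis by (simp add: lie_bracket_def pushforward_def)
  next
    case True
    then obtain W where W: "open W" "F p \<in> W" "smooth_fun \<A>\<^sub>N W f" by (auto simp: smooth_near_def)
    have near: "smooth_near \<A>\<^sub>N y f" if "y \<in> W" for y
      using smooth_nearI[OF W(1) that W(3)] .
    have oF: "open (\<Omega> \<inter> F -` W)"
      using smooth_F W(1) M.open_U by (simp add: smooth_map_def open_vimage open_Int)
    have second: "A (F p) (\<lambda>y. B y f) = X p (\<lambda>x. Y x (f \<circ> F))"
      if X: "X \<in> M.VF" "A \<in> N.VF" "related X A" and Y: "Y \<in> M.VF" "B \<in> N.VF" "related Y B" for X A Y B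
    proof -
      have h: "smooth_near \<A>\<^sub>N (F p) (\<lambda>y. B y f)"
      proof (rule smooth_nearI[of "U \<inter> W"])
        show "smooth_fun \<A>\<^sub>N (U \<inter> W) (\<lambda>y. B y f)"
          by (rule vfields_smooth[OF Y(2)])
            (use W smooth_fun_subset[OF W(3)] N.open_U in auto)
      qed (use W p F_in_U N.open_U in auto)
      have "A (F p) (\<lambda>y. B y f) = X p ((\<lambda>y. B y f) \<circ> F)"
        by (rule related_derivative[OF X(2,3) h p])
      \<comment> \<open>The two functions agree only where \<open>F\<close> maps into
        \<open>W\<close>, where \<open>f\<close> is known to be smooth; a tangent vector sees no
        more than this germ.\<close>
      also have "\<dots> = X p (\<lambda>x. Y x (f \<circ> F))"
      proof (rule tangent_cong[OF M.VF_T[OF X(1) p]])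
        show "smooth_near \<A>\<^sub>M p ((\<lambda>y. B y f) \<circ> F)"
          by (rule smooth_near_compose[OF M.manifold N.manifold smooth_F h])
        have "((\<lambda>y. B y f) \<circ> F) x = Y x (f \<circ> F)" if "x \<in> \<Omega> \<inter> F -` W" for x
          using that near related_derivative[OF Y(2,3)] by simp
        then show "\<forall>\<^sub>F x in nhds p. ((\<lambda>y. B y f) \<circ> F) x = Y x (f \<circ> F)"
          using oF W p unfolding eventually_nhds by (intro exI[of _ "\<Omega> \<inter> F -` W"]) auto
      qed
      finally show ?thesis .
    qed
    have "smooth_near \<A>\<^sub>M p (f \<circ> F)"
      by (rule smooth_near_compose[OF M.manifold N.manifold smooth_F True])
    then show ?thesis
      using True second[OF X Y] second[OF Y X] by (simp add: lie_bracket_def pushforward_def)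
  qed
qed

lemma shape_sym_range: "p \<in> \<Omega> \<Longrightarrow> N.shape_sym (F p)"
  by (rule N.shape_symI)
    (simp_all add: F_in_U lie_bracket_related[OF SH_VF[OF Xs(1)] N.E_VF Xs(2) SH_VF[OF Xs(1)] N.E_VF Xs(2)]
      push_D M.VF_T M.lie_VF SH_VF[OF Xs(1)])

text \<open>By the Koszul formula, since metrics and brackets of horizontal fields correspond under \<open>F\<close>.\<close>

lemma connection_related:
  assumes X: "X \<in> SH" "A \<in> N.SD" "related X A" and Y: "Y \<in> SH" "B \<in> N.SD" "related Y B"
    and Z: "Z \<in> SH" "C \<in> N.SD" "related Z C" and p: "p \<in> \<Omega>"
  shows "gN (F p) (nabN (F p) (A (F p)) B) (C (F p)) = gM p (nabM p (X p) Y) (Z p)"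
proof -
  note VF = SH_VF[OF X(1)] N.SD_VF[OF X(2)] SH_VF[OF Y(1)] N.SD_VF[OF Y(2)]
    SH_VF[OF Z(1)] N.SD_VF[OF Z(2)]
  have deriv: "A (F p) (\<lambda>y. gN y (B y) (C y)) = X p (\<lambda>x. gM x (Y x) (Z x))"
    if "X \<in> SH" "A \<in> N.SD" "related X A" "Y \<in> SH" "B \<in> N.SD" "related Y B"
      "Z \<in> SH" "C \<in> N.SD" "related Z C" for X A Y B Z C
  proof -
    have s: "N.CF (\<lambda>y. gN y (B y) (C y))" using that N.g_smooth N.SD_VF by blast
    have "A (F p) (\<lambda>y. gN y (B y) (C y)) = X p ((\<lambda>y. gN y (B y) (C y)) \<circ> F)"
      using related_derivative[OF N.SD_VF that(3) N.CF_near[OF s F_in_U[OF p]] p] that by blast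
    also have "\<dots> = X p (\<lambda>x. gM x (Y x) (Z x))"
      by (rule M.derivation_cong[OF _ p, symmetric])
        (use that p in \<open>auto simp: M.VF_T SH_VF relatedD isometry SH_Hor intro!: M.g_smooth\<close>)
    finally show ?thesis .
  qed
  have lie: "gN (F p) (lie_bracket \<A>\<^sub>N A B (F p)) (C (F p)) = gM p (lie_bracket \<A>\<^sub>M X Y p) (Z p)"
    if "X \<in> SH" "A \<in> N.SD" "related X A" "Y \<in> SH" "B \<in> N.SD" "related Y B"
      "Z \<in> SH" "related Z C" for X A Y B Z C
    using that lie_bracket_related[OF SH_VF N.SD_VF _ SH_VF N.SD_VF _ p, of X A Y B] p
      relatedD[OF that(8) p]
    by (simp add: g_push M.VF_T M.lie_VF SH_VF SH_Hor)
  have "2 * gN (F p) (nabN (F p) (A (F p)) B) (C (F p)) = 2 * gM p (nabM p (X p) Y) (Z p)"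
    unfolding N.koszul[OF VF(2,4,6) F_in_U[OF p]] M.koszul[OF VF(1,3,5) p]
      deriv[OF X Y Z] deriv[OF Y X Z] deriv[OF Z X Y] lie[OF X Y Z(1,3)] lie[OF X Z Y(1,3)]
      lie[OF Y Z X(1,3)] ..
  then show ?thesis by simp
qed

text \<open>Both sides lie in \<open>D (F p)\<close>, hence are determined by their inner products
  with the frame \<open>As\<close>. These are compared through the horizontal fields
  \<open>Xs\<close>, which serve as test fields for \<open>connection_related\<close>.\<close>

lemma push_nab:
  assumes X: "X \<in> SH" "A \<in> N.SD" "related X A" and Y: "Y \<in> SH" "B \<in> N.SD" "related Y B" and p: "p \<in> \<Omega>"
  shows "push p (nabM p (X p) Y) = N.P (F p) (nabN (F p) (A (F p)) B)"
proof -
  note q = F_in_U[OF p]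
  have T: "nabM p (X p) Y \<in> M.T p" "nabN (F p) (A (F p)) B \<in> N.T (F p)"
    using M.nab_T[OF p M.VF_T[OF SH_VF[OF X(1)] p] SH_VF[OF Y(1)]]
      N.nab_T[OF q N.VF_T[OF N.SD_VF[OF X(2)] q] N.SD_VF[OF Y(2)]] .
  have "gN (F p) (push p (nabM p (X p) Y)) (As i (F p)) = gN (F p) (nabN (F p) (A (F p)) B) (As i (F p))"
    if i: "i \<in> I" for i
    using connection_related[OF X Y Xs(1)[OF i] N.E(1)[OF i] Xs(2)[OF i] p]
      g_push[OF T(1) SH_Hor[OF Xs(1)[OF i] p]] relatedD[OF Xs(2)[OF i] p] by simp
  then show ?thesis
    using N.D_expand[OF q push_D[OF T(1)]] by (simp add: N.P_eq[OF q T(2)])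
qed

text \<open>On the range the adjoint inverts the isometry from the horizontal space; uniqueness in
  the definite description is nondegeneracy of \<open>gM\<close>.\<close>

lemma adjoint_push:
  assumes h: "h \<in> Hor x"
  shows "adjoint_at \<A>\<^sub>M gM \<A>\<^sub>N gN F x (push x h) = h"
  unfolding adjoint_at_def
proof (rule the_equality)
  have *: "gM x h v = gN (F x) (push x h) (push x v)" if "v \<in> M.T x" for v
    using g_push[OF that h] that h push_D[OF that] push_D[OF Hor_T[OF h]]
    by (simp add: M.g_sym[of h] N.g_sym[of "push x h"] Hor_T N.D_in_T)
  then show "h \<in> M.T x \<and> (\<forall>v\<in>M.T x. gM x h v = gN (F x) (push x h) (push x v))"
    using Hor_T[OF h] by blast
  fix u assume u: "u \<in> M.T x \<and> (\<forall>v\<in>M.T x. gM x u v = gN (F x) (push x h) (push x v))"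
  have "u - h = 0"
    by (rule M.g_nondegenerate[of _ x]) (use u * Hor_T[OF h] in \<open>auto simp: M.T_diff M.g_diff_left\<close>)
  then show "u = h" by simp
qed

lemma push_adjoint:
  assumes "w \<in> D (F x)"
  shows "push x (adjoint_at \<A>\<^sub>M gM \<A>\<^sub>N gN F x w) = w"
  using push_Hor[OF assms] adjoint_push by auto

text \<open>The adjoint is defined pointwise, so smoothness of the lifted field has to be shown
  before it can be differentiated; on \<open>\<Omega>\<close> the lift is identified with an
  explicit combination of the \<open>Xs\<close>.\<close>

lemma adjoint_field:
  assumes C: "C \<in> N.SD"
  shows "(\<lambda>x. adjoint_at \<A>\<^sub>M gM \<A>\<^sub>N gN F x (C (F x))) \<in> SH" (is "?Y \<in> _")
    and "related (\<lambda>x. adjoint_at \<A>\<^sub>M gM \<A>\<^sub>N gN F x (C (F x))) C"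
proof -
  have Hor: "?Y x \<in> Hor x" if x: "x \<in> \<Omega>" for x
  proof -
    obtain h where "h \<in> Hor x" "push x h = C (F x)"
      using push_Hor[OF N.SD_D[OF C F_in_U[OF x]]] by blast
    then show ?thesis using adjoint_push by metis
  qed
  \<comment> \<open>The coefficients of \<open>C\<close> in the frame \<open>As\<close>; composed
    with \<open>F\<close> they become the coefficients of the lift.\<close>
  define c where "c = (\<lambda>i y. gN y (C y) (As i y))"
  have "(\<Sum>i\<in>I. c i (F x) *\<^sub>R Xs i x) = ?Y x" if x: "x \<in> \<Omega>" for x
  proof -
    have "subspace (Hor x)"
      unfolding subspace_def
      by (auto simp: horizontal_def orth_compl_def ker_dist_def M.T_0 M.T_add M.T_scale M.g_0_left
          M.g_add_left M.g_scale_left)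
    then have "(\<Sum>i\<in>I. c i (F x) *\<^sub>R Xs i x) \<in> Hor x"
      by (intro subspace_sum subspace_scale SH_Hor[OF Xs(1) x])
    moreover have "push x (\<Sum>i\<in>I. c i (F x) *\<^sub>R Xs i x) = C (F x)"
      using N.D_expand[OF F_in_U[OF x] N.SD_D[OF C F_in_U[OF x]]] relatedD[OF Xs(2) x]
      by (simp add: c_def pushforward_sum pushforward_scale)
    ultimately show ?thesis using adjoint_push by metis
  qed
  moreover have "(\<lambda>x. \<Sum>i\<in>I. c i (F x) *\<^sub>R Xs i x) \<in> M.VF"
  proof (intro M.VF_sum M.VF_scale SH_VF[OF Xs(1)])
    fix i assume "i \<in> I"
    then have "N.CF (c i)" unfolding c_def using N.g_smooth N.SD_VF[OF C] N.E_VF by blast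
    then have "smooth_fun \<A>\<^sub>M (F -` U) (c i \<circ> F)"
      by (rule smooth_fun_compose[OF M.manifold N.manifold smooth_F N.open_U])
    then show "M.CF (\<lambda>x. c i (F x))"
      using smooth_fun_subset[of \<A>\<^sub>M "F -` U" "c i \<circ> F" \<Omega>] F_U by (auto simp: comp_def)
  qed
  ultimately have "?Y \<in> M.VF" by (rule M.VF_cong)
  then show "?Y \<in> SH" using Hor by (simp add: sections_def)
  show "related ?Y C"
    using push_adjoint N.SD_D[OF C F_in_U] by (simp add: F_related_def)
qed

text \<open>The adjoint of \<open>S\<^sub>V B\<close> is a horizontal field related to
  \<open>S\<^sub>V B\<close>, so \<open>push_nab\<close> replaces the derivative on the source by a
  projected derivative on the target, the form in which the curvature yields it.\<close>

lemma shape_deriv_eq: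
  assumes X: "X \<in> SH" "A \<in> N.SD" "related X A" and B: "B \<in> N.SD" and V: "V \<in> N.SN" and p: "p \<in> \<Omega>"
  shows "shape_deriv \<A>\<^sub>M gM nabM \<A>\<^sub>N gN nabN F D X A V B p =
    N.P (F p) (nabN (F p) (A (F p)) (\<lambda>y. N.S y V (B y)))
    - N.S (F p) (cov N.nn A V) (B (F p)) - N.S (F p) V (N.P (F p) (nabN (F p) (A (F p)) B))"
proof -
  have C: "(\<lambda>y. N.S y V (B y)) \<in> N.SD"
    using N.shape_SD N.SD_VF[OF B] N.SN_VF[OF V] by blast
  show ?thesis
    using push_nab[OF X adjoint_field(1)[OF C] C adjoint_field(2)[OF C] p] relatedD[OF X(3) p]
    by (simp add: shape_deriv_def)
qed

end

theorem theorem3p3: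
  fixes \<A>\<^sub>M :: "('m::{t2_space,second_countable_topology}, 'e::euclidean_space) atlas"
    and \<A>\<^sub>N :: "('n::{t2_space,second_countable_topology}, 'd::euclidean_space) atlas"
    and gM :: "'m metric_tensor" and gN :: "'n metric_tensor"
    and nabM :: "'m conn" and nabN :: "'n conn"
    and F :: "'m \<Rightarrow> 'n" and D :: "'n distribution"
    and r n1 :: nat and \<Omega> :: "'m set" and p :: 'm and U :: "'n set"
    and X Y :: "'m vfield" and A B V W :: "'n vfield"
    and Xs :: "nat \<Rightarrow> 'm vfield" and As e :: "nat \<Rightarrow> 'n vfield"
  assumes manifolds: "smooth_manifold \<A>\<^sub>M" "smooth_manifold \<A>\<^sub>N"
    and metrics: "riemannian_metric \<A>\<^sub>M gM" "riemannian_metric \<A>\<^sub>N gN"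
    and connections: "levi_civita \<A>\<^sub>M gM nabM" "levi_civita \<A>\<^sub>N gN nabN"
    and F: "riemannian_map \<A>\<^sub>M gM \<A>\<^sub>N gN F"
    and r: "\<And>p. dim (ker_dist \<A>\<^sub>M \<A>\<^sub>N F p) = r"
    and D: "smooth_distribution \<A>\<^sub>N (DIM('e) - r) D"
      "\<And>p. D (F p) = range_at \<A>\<^sub>M \<A>\<^sub>N F p"
    and n1: "\<And>q. dim (orth_compl \<A>\<^sub>N gN D q) = n1"
    and tot_geod: "perp_totally_geodesic \<A>\<^sub>N gN nabN D"
    and opens: "open \<Omega>" "open U" "F ` \<Omega> \<subseteq> U"
    and X: "X \<in> sections \<A>\<^sub>M (horizontal \<A>\<^sub>M \<A>\<^sub>N gM F) \<Omega>"
      "A \<in> sections \<A>\<^sub>N D U" "F_related \<A>\<^sub>N F \<Omega> X A"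
    and Y: "Y \<in> sections \<A>\<^sub>M (horizontal \<A>\<^sub>M \<A>\<^sub>N gM F) \<Omega>"
      "B \<in> sections \<A>\<^sub>N D U" "F_related \<A>\<^sub>N F \<Omega> Y B"
    and VW: "V \<in> sections \<A>\<^sub>N (orth_compl \<A>\<^sub>N gN D) U"
      "W \<in> sections \<A>\<^sub>N (orth_compl \<A>\<^sub>N gN D) U"
    and Xs: "\<And>j. j \<in> {r+1..DIM('e)} \<Longrightarrow>
        Xs j \<in> sections \<A>\<^sub>M (horizontal \<A>\<^sub>M \<A>\<^sub>N gM F) \<Omega> \<and>
        As j \<in> sections \<A>\<^sub>N D U \<and> F_related \<A>\<^sub>N F \<Omega> (Xs j) (As j)"
      "orthonormal_frame gN D U {r+1..DIM('e)} As"
    and e: "\<And>k. k \<in> {1..n1} \<Longrightarrow> e k \<in> sections \<A>\<^sub>N (orth_compl \<A>\<^sub>N gN D) U"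
      "orthonormal_frame gN (orth_compl \<A>\<^sub>N gN D) U {1..n1} e"
    and p: "p \<in> \<Omega>"
  shows
    "let q = F p; g = gN q; m = DIM('e);
         S = (\<lambda>V A x. shape gN nabN D x V (A x));
         nab = cov nabN;
         nabp = cov (normal_conn \<A>\<^sub>N gN nabN D);
         nabF = (\<lambda>Z V x. normal_conn \<A>\<^sub>N gN nabN D (F x) (pushforward \<A>\<^sub>N F x (Z x)) V);
         adj = (\<lambda>C x. adjoint_at \<A>\<^sub>M gM \<A>\<^sub>N gN F x (C (F x)));
         dS = (\<lambda>X A V B. shape_deriv \<A>\<^sub>M gM nabM \<A>\<^sub>N gN nabN F D X A V B p)
     in
       ricci \<A>\<^sub>N nabN q (A q) (B q) =
         ricci_part \<A>\<^sub>N gN nabN {r+1..m} As A B q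
         - (\<Sum>k=1..n1. g (S (nabp (e k) (e k)) A q) (B q)
              - g (nab (e k) (S (e k) A) q) (B q)
              + g (S (e k) A q) (S (e k) B q)
              + g (nab (e k) A q) (S (e k) B q))
     \<and> ricci \<A>\<^sub>N nabN q (V q) (W q) =
         ricci_part \<A>\<^sub>N gN nabN {1..n1} e V W q
         - (\<Sum>j=r+1..m. g (S (nabp V W) (As j) q) (As j q)
              + g (S V (As j) q) (S W (As j) q)
              - V q (\<lambda>x. gN x (S W (As j) x) (As j x))
              + 2 * g (S W (As j) q) (nab V (As j) q))
     \<and> ricci \<A>\<^sub>N nabN q (A q) (V q) =
         (\<Sum>j=r+1..m. g (dS X A V (As j)) (As j q) - g (dS (Xs j) (As j) V A) (As j q))
         - (\<Sum>k=1..n1. g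
              (nabF X (nabp (e k) V) p
               - nabp (e k) (nabp A V) q
               - normal_conn \<A>\<^sub>N gN nabN D q (nabF X (e k) p) V
               + nabF (adj (S (e k) A)) V p
               + nabF (adj (nab (e k) A)) V p)
              (e k q))"
proof -
  note frame = Xs(1)
  interpret framed_riemannian_map \<A>\<^sub>M gM nabM \<Omega> \<A>\<^sub>N gN nabN U D "{r+1..DIM('e)}" "{1..n1}" As e F Xs
  proof unfold_locales
    show "subspace (D x)" "D x \<subseteq> tangent_space \<A>\<^sub>N x" for x
      using D(1) unfolding smooth_distribution_def by blast+
    show "D (F x) = range_at \<A>\<^sub>M \<A>\<^sub>N F x" for x by (rule D(2))
  qed (use manifolds metrics connections F tot_geod opens Xs e in simp_all)
  define q where "q = F p"
  have q: "q \<in> U" using F_in_U[OF p] by (simp add: q_def)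
  have sym: "N.shape_sym q" using shape_sym_range[OF p] by (simp add: q_def)
  have push: "pushforward \<A>\<^sub>N F p (X p) = A q" using relatedD[OF X(3) p] by (simp add: q_def)
  note VF = N.SD_VF[OF X(2)] N.SD_VF[OF Y(2)] N.SN_VF[OF VW(1)] N.SN_VF[OF VW(2)]
  have ek: "e k \<in> N.SN" "e k q \<in> N.N q" if "k \<in> {1..n1}" for k
    using e(1)[OF that] N.SN_N q by auto
  have Asj: "Xs j \<in> SH" "As j \<in> N.SD" "related (Xs j) (As j)" "As j q \<in> D q"
    if "j \<in> {r+1..DIM('e)}" for j
    using frame[OF that] N.SD_D q by auto
  have 1: "ricci \<A>\<^sub>N nabN q (A q) (B q) =
      ricci_part \<A>\<^sub>N gN nabN {r+1..DIM('e)} As A B q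
      - (\<Sum>k=1..n1. gN q (N.S q (cov N.nn (e k) (e k)) (A q)) (B q)
           - gN q (nabN q (e k q) (\<lambda>x. N.S x (e k) (A x))) (B q)
           + gN q (N.S q (e k) (A q)) (N.S q (e k) (B q))
           + gN q (nabN q (e k q) A) (N.S q (e k) (B q)))"
    unfolding N.ricci_split[OF q VF(1,2)] ricci_part_def
    by (simp add: N.curvature_mixed_tangent[OF q ek(1) X(2) Y(2) sym] sum_negf[symmetric])
  have 2: "ricci \<A>\<^sub>N nabN q (V q) (W q) =
      ricci_part \<A>\<^sub>N gN nabN {1..n1} e V W q
      - (\<Sum>j=r+1..DIM('e). gN q (N.S q (cov N.nn V W) (As j q)) (As j q)
           + gN q (N.S q V (As j q)) (N.S q W (As j q))
           - V q (\<lambda>x. gN x (N.S x W (As j x)) (As j x))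
           + 2 * gN q (N.S q W (As j q)) (nabN q (V q) (As j)))"
    unfolding N.ricci_split[OF q VF(3,4)] ricci_part_def
    by (simp add: N.curvature_mixed_normal[OF q Asj(2) VW sym] sum_negf[symmetric])
  let ?adj = "adjoint_at \<A>\<^sub>M gM \<A>\<^sub>N gN F p"
  \<comment> \<open>Both vectors lie in \<open>D q\<close>, the second because derivatives in normal
    directions preserve \<open>D\<close>; hence pushing forward undoes the adjoint, and the last two
    terms are normal derivatives along the vectors themselves.\<close>
  have adj: "pushforward \<A>\<^sub>N F p (?adj (N.S q (e k) (A q))) = N.S q (e k) (A q)"
      "pushforward \<A>\<^sub>N F p (?adj (nabN q (e k q) A)) = nabN q (e k q) A"
    if "k \<in> {1..n1}" for k
  proof -
    have "N.S q (e k) (A q) \<in> D q"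
      using N.shape_D[OF q N.VF_T[OF VF(1) q] N.SN_VF[OF ek(1)[OF that]]] .
    moreover have "nabN q (e k q) A \<in> D q"
      using N.nab_N_D[OF q ek(2)[OF that] X(2)] .
    ultimately show "pushforward \<A>\<^sub>N F p (?adj (N.S q (e k) (A q))) = N.S q (e k) (A q)"
      "pushforward \<A>\<^sub>N F p (?adj (nabN q (e k q) A)) = nabN q (e k q) A"
      unfolding q_def by (simp_all add: push_adjoint)
  qed
  have 3: "ricci \<A>\<^sub>N nabN q (A q) (V q) =
      (\<Sum>j=r+1..DIM('e).
          gN q (shape_deriv \<A>\<^sub>M gM nabM \<A>\<^sub>N gN nabN F D X A V (As j) p) (As j q)
        - gN q (shape_deriv \<A>\<^sub>M gM nabM \<A>\<^sub>N gN nabN F D (Xs j) (As j) V A p) (As j q))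
      - (\<Sum>k=1..n1. gN q
          (N.nn q (A q) (cov N.nn (e k) V) - cov N.nn (e k) (cov N.nn A V) q
            - N.nn q (N.nn q (A q) (e k)) V
            + N.nn q (pushforward \<A>\<^sub>N F p (?adj (N.S q (e k) (A q)))) V
            + N.nn q (pushforward \<A>\<^sub>N F p (?adj (nabN q (e k q) A))) V) (e k q))"
    \<comment> \<open>The sum over the \<open>As\<close> is rewritten by \<open>codazzi\<close>,
      whose two groups are the two derivatives of the shape operator, and the sum over the
      \<open>e k\<close> by \<open>curvature_normal\<close>.\<close>
    unfolding N.ricci_split[OF q VF(1,3)]
    by (simp add: N.curvature_normal[OF q ek(1) X(2) VW(1) ek(2)] adj sum_negf
        N.codazzi[OF q X(2) Asj(2) VW(1) Asj(4)]
        shape_deriv_eq[OF X Asj(2) VW(1) p, folded q_def]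
        shape_deriv_eq[OF Asj(1-3) X(2) VW(1) p, folded q_def])
  show ?thesis
    using 1 2 3 by (simp add: Let_def cov_apply push q_def[symmetric])
qed

end
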